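(* Let $X$ be a complete $\mathrm{CAT}(1)$ space such that $d(v,v')<\pi/2$ for every $v,v'\in X$. Let $f_1,f_2,\ldots,f_r$ be a finite number of proper lower semicontinuous convex functions from $X$ into $(-\infty,\infty]$ such that $F:=\bigcap_{i=1}^r\operatorname{argmin}_Xf_i\neq\emptyset$, and let $\alpha_{n,1},\alpha_{n,2},\ldots,\alpha_{n,r}$ be real numbers for $n\in\mathbb{N}$ such that $\alpha_{n,i}\in[a,1-a]$ for every $n\in\mathbb{N}$ and $i=1,2,\ldots,r$, where $0<a<1/2$. For $i=1,2,\ldots,r$, let $R_{f_i}$ be a resolvent of $f_i$ defined by either \[ R_{f_i}x:=\operatorname{argmin}_{y\in X}\{f_i(y)+\tan d(y,x)\sin d(y,x)\}\quad (x\in X) \] or \[ R_{f_i}x:=\operatorname{argmin}_{y\in X}\{f_i(y)-\log\cos d(y,x)\}\quad (x\in X). \] For $n\in\mathbb{N}$, let $W_n$ be the $W$-mapping of $X$ into itself generated by $R_{f_1},R_{f_2},\ldots,R_{f_r}$ and $\alpha_{n,1},\alpha_{n,2},\ldots,\alpha_{n,r}$. Let $\{\beta_n\}$ be a sequence of real numbers such that $0<\beta_n<1$ for every $n\in\mathbb{N}$, $\lim_{n\to\infty}\beta_n=0$, and $\sum_{n=1}^\infty\beta_n=\infty$. For given points $u,x_1\in X$, let $\{x_n\}$ be the sequence in $X$ generated by \[ x_{n+1}=\beta_nu\oplus(1-\beta_n)W_nx_n \] for $n\in\mathbb{N}$. Suppose that one of the following conditions holds: (a) $\sup_{v,v'\in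 X}d(v,v')<\pi/2$; (b) $d(u,P_Fu)<\pi/4$ and $d(u,P_Fu)+d(x_1,P_Fu)<\pi/2$; (c) $\sum_{n=1}^\infty\beta_n^2=\infty$. Then $\{x_n\}$ converges (in the metric $d$) to $P_Fu$.
   Context: Let $(X,d)$ be a metric space. A geodesic of $x,y\in X$ is a mapping $c:[0,l]\to X$ with $c(0)=x$, $c(l)=y$ and $d(c(s),c(t))=|s-t|$ for all $s,t\in[0,l]$. The space $X$ is always assumed to be $\pi$-geodesic (a geodesic of $x,y$ exists whenever $d(x,y)<\pi$) and every geodesic is assumed to be unique; $[x,y]:=c([0,l])$ is the geodesic segment. For $t\in[0,1]$, $tx\oplus(1-t)y:=c((1-t)l)$, where $c$ is the geodesic of $x,y$ and $l=d(x,y)$; i.e. it is the point $z\in[x,y]$ with $d(x,z)=(1-t)d(x,y)$. A subset $C$ is convex if $[x,y]\subset C$ for all $x,y\in C$. $\mathrm{CAT}(1)$ space: Let $\mathbb{S}^2$ be the unit sphere in $\mathbb{R}^3$ with spherical metric $d_{\mathbb{S}^2}$. For $x,y,z\in X$ with $d(x,y)+d(y,z)+d(z,x)<2\pi$ there are $\overline{x},\overline{y},\overline{z}\in\mathbb{S}^2$ with the same pairwise distances. For $p\in[x,y]$, a comparison point is $\overline{p}\in[\overline{x},\overline{y}]$ with $d_{\mathbb{S}^2}(\overline{x},\overline{p})=d(x,p)$ (similarly for the other sides). $X$ is a $\mathrm{CAT}(1)$ space if for every such triangle and all $p,q\in[x,y]\cup[y,z]\cup[z,x]$ with comparison points $\overline{p},\overline{q}$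 one has $d(p,q)\le d_{\mathbb{S}^2}(\overline{p},\overline{q})$. Functions: $f:X\to(-\infty,\infty]$ is lower semicontinuous if $\{x\in X\mid f(x)\le b\}$ is closed for all $b\in\mathbb{R}$; proper if $\{x\in X\mid f(x)\ne\infty\}$ is nonempty; convex if $f(tx\oplus(1-t)y)\le tf(x)+(1-t)f(y)$ for all $x,y\in X$ and $t\in(0,1)$. $\operatorname{argmin}_Xf$ is the set of minimizers of $f$ on $X$. For $X$ as in the claim and $f$ proper, lower semicontinuous and convex, it is known that each of the two argmin sets defining the resolvents consists of exactly one point, and $R_fx$ denotes that point. It is also known that both resolvents are quasinonexpansive (i.e. $d(R_fx,p)\le d(x,p)$ for all $x\in X$ and all fixed points $p$ of $R_f$), that both are $\Delta$-demiclosed, and that the fixed point set of each is $\operatorname{argmin}_Xf$. Here, for a bounded sequence $\{x_n\}$, $AC(\{x_n\}):=\{z\mid \limsup_{n}d(z,x_n)=\inf_{x\in X}\limsup_{n}d(x,x_n)\}$; $\{x_n\}$ is $\Delta$-convergent to $z$ if $AC(\{x_{n_i}\})=\{z\}$ for every subsequence; and $T$ is $\Delta$-demiclosed if for any $\Delta$-convergent sequence $\{x_n\}$ with $\lim_{n}d(Tx_n,x_n)=0$ its $\Delta$-limit is a fixed point of $T$. $W$-mapping: for mappings $T_1,\ldots,T_r:X\to X$ and $\alpha_1,\ldots,\alpha_r\in[0,1]$, put $U_1:=\alpha_1T_1\oplus(1-\alpha_1)I$ and $U_k:=\alpha_kT_kU_{k-1}\oplus(1-\alpha_k)I$ for $k=2,\ldots,r$,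 where $I$ is the identity and these operations are pointwise (e.g. $U_kx=\alpha_kT_kU_{k-1}x\oplus(1-\alpha_k)x$). The $W$-mapping generated by $T_1,\ldots,T_r$ and $\alpha_1,\ldots,\alpha_r$ is $W:=U_r$. Metric projection: if $X$ is a complete $\mathrm{CAT}(1)$ space with $d(v,v')<\pi/2$ for all $v,v'\in X$ and $C\subset X$ is nonempty, closed and convex, then for each $x\in X$ there is a unique point $P_Cx\in C$ with $d(x,P_Cx)=\inf_{y\in C}d(x,y)$. The set $F$ in the claim is closed and convex, so $P_F$ is defined. *)

theory Defs
  imports "HOL-Analysis.Analysis"
begin

text \<open>
  A geodesic of \<open>x\<close>, \<open>y\<close> is only relevant on its domain \<open>[0, l]\<close>, and \<open>l = d x y\<close> is forced by
  the isometry condition; so the domain is written \<open>{0..d x y}\<close> and the values of \<open>c\<close>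
  elsewhere are junk. Carrier and metric are parameters because the notion is used both for the
  space \<open>X\<close> (a type of class \<^class>\<open>metric_space\<close>) and for the sphere with its angular metric.
\<close>

definition geodesic_on :: "'b set \<Rightarrow> ('b \<Rightarrow> 'b \<Rightarrow> real) \<Rightarrow> 'b \<Rightarrow> 'b \<Rightarrow> (real \<Rightarrow> 'b) \<Rightarrow> bool" where
  "geodesic_on S d x y c \<longleftrightarrow>
     c ` {0..d x y} \<subseteq> S \<and> c 0 = x \<and> c (d x y) = y \<and>
     (\<forall>s\<in>{0..d x y}. \<forall>t\<in>{0..d x y}. d (c s) (c t) = \<bar>s - t\<bar>)"

definition segment_on :: "'b set \<Rightarrow> ('b \<Rightarrow> 'b \<Rightarrow> real) \<Rightarrow> 'b \<Rightarrow> 'b \<Rightarrow> 'b set" where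
  "segment_on S d x y = {z. \<exists>c. geodesic_on S d x y c \<and> z \<in> c ` {0..d x y}}"

abbreviation geodesic :: "'a::metric_space \<Rightarrow> 'a \<Rightarrow> (real \<Rightarrow> 'a) \<Rightarrow> bool" where
  "geodesic \<equiv> geodesic_on UNIV dist"

abbreviation segment :: "'a::metric_space \<Rightarrow> 'a \<Rightarrow> 'a set" where
  "segment \<equiv> segment_on UNIV dist"

text \<open>
  \<open>geocomb t x y\<close> is the point \<open>t x \<oplus> (1 - t) y\<close>; it is well defined for \<open>t \<in> [0, 1]\<close> when
  the geodesic of \<open>x\<close>, \<open>y\<close> exists and is unique.
\<close>

definition geocomb :: "real \<Rightarrow> 'a::metric_space \<Rightarrow> 'a \<Rightarrow> 'a" where
  "geocomb t x y = (THE z. \<exists>c. geodesic x y c \<and> z = c ((1 - t) * dist x y))"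

abbreviation S2 :: "(real^3) set" where
  "S2 \<equiv> sphere 0 1"

definition dist_S2 :: "real^3 \<Rightarrow> real^3 \<Rightarrow> real" where
  "dist_S2 p q = arccos (p \<bullet> q)"

definition comparison_triangle ::
  "'a::metric_space \<Rightarrow> 'a \<Rightarrow> 'a \<Rightarrow> real^3 \<Rightarrow> real^3 \<Rightarrow> real^3 \<Rightarrow> bool" where
  "comparison_triangle x y z x' y' z' \<longleftrightarrow>
     x' \<in> S2 \<and> y' \<in> S2 \<and> z' \<in> S2 \<and>
     dist_S2 x' y' = dist x y \<and> dist_S2 y' z' = dist y z \<and> dist_S2 z' x' = dist z x"

definition comparison_on_side ::
  "'a::metric_space \<Rightarrow> 'a \<Rightarrow> real^3 \<Rightarrow> real^3 \<Rightarrow> 'a \<Rightarrow> real^3 \<Rightarrow> bool" where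
  "comparison_on_side x y x' y' p p' \<longleftrightarrow>
     p \<in> segment x y \<and> p' \<in> segment_on S2 dist_S2 x' y' \<and> dist_S2 x' p' = dist x p"

definition comparison_point ::
  "'a::metric_space \<Rightarrow> 'a \<Rightarrow> 'a \<Rightarrow> real^3 \<Rightarrow> real^3 \<Rightarrow> real^3 \<Rightarrow> 'a \<Rightarrow> real^3 \<Rightarrow> bool" where
  "comparison_point x y z x' y' z' p p' \<longleftrightarrow>
     comparison_on_side x y x' y' p p' \<or>
     comparison_on_side y z y' z' p p' \<or>
     comparison_on_side z x z' x' p p'"

text \<open>
  The first two conjuncts are the standing assumptions on the space: it is \<open>\<pi>\<close>-geodesic and
  its geodesics are unique. Comparison triangles exist whenever the perimeter is less than
  \<open>2 \<pi>\<close> and are unique up to isometry of the sphere.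
\<close>

definition CAT1_space :: "'a::metric_space itself \<Rightarrow> bool" where
  "CAT1_space TYPE('a) \<longleftrightarrow>
     (\<forall>x y::'a. dist x y < pi \<longrightarrow> (\<exists>c. geodesic x y c)) \<and>
     (\<forall>(x::'a) y c c'. geodesic x y c \<and> geodesic x y c' \<longrightarrow> (\<forall>s\<in>{0..dist x y}. c s = c' s)) \<and>
     (\<forall>(x::'a) y z x' y' z' p q p' q'.
        dist x y + dist y z + dist z x < 2 * pi \<and>
        comparison_triangle x y z x' y' z' \<and>
        comparison_point x y z x' y' z' p p' \<and>
        comparison_point x y z x' y' z' q q' \<longrightarrow>
        dist p q \<le> dist_S2 p' q')"

definition lower_semicont :: "('a::metric_space \<Rightarrow> ereal) \<Rightarrow> bool" where
  "lower_semicont f \<longleftrightarrow> (\<forall>b::real. closed {x. f x \<le> ereal b})"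

definition proper_fun :: "('a \<Rightarrow> ereal) \<Rightarrow> bool" where
  "proper_fun f \<longleftrightarrow> {x. f x \<noteq> \<infinity>} \<noteq> {}"

definition geoconvex_fun :: "('a::metric_space \<Rightarrow> ereal) \<Rightarrow> bool" where
  "geoconvex_fun f \<longleftrightarrow>
     (\<forall>x y. \<forall>t\<in>{0<..<1}. f (geocomb t x y) \<le> ereal t * f x + ereal (1 - t) * f y)"

definition argmin_set :: "('a \<Rightarrow> ereal) \<Rightarrow> 'a set" where
  "argmin_set f = {x. is_arg_min f (\<lambda>_. True) x}"

definition resolvent_tan_sin :: "('a::metric_space \<Rightarrow> ereal) \<Rightarrow> 'a \<Rightarrow> 'a" where
  "resolvent_tan_sin f x =
     (THE z. z \<in> argmin_set (\<lambda>y. f y + ereal (tan (dist y x) * sin (dist y x))))"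

definition resolvent_log_cos :: "('a::metric_space \<Rightarrow> ereal) \<Rightarrow> 'a \<Rightarrow> 'a" where
  "resolvent_log_cos f x =
     (THE z. z \<in> argmin_set (\<lambda>y. f y - ereal (ln (cos (dist y x)))))"

text \<open>
  The mappings and weights are indexed from 1. Starting the recursion with \<open>U\<^sub>0 = I\<close> makes
  \<open>U\<^sub>1 = \<alpha>\<^sub>1 T\<^sub>1 \<oplus> (1 - \<alpha>\<^sub>1) I\<close> an instance of the general step.
\<close>

primrec W_mapping :: "(nat \<Rightarrow> 'a::metric_space \<Rightarrow> 'a) \<Rightarrow> (nat \<Rightarrow> real) \<Rightarrow> nat \<Rightarrow> 'a \<Rightarrow> 'a" where
  "W_mapping T \<alpha> 0 x = x"
| "W_mapping T \<alpha> (Suc k) x = geocomb (\<alpha> (Suc k)) (T (Suc k) (W_mapping T \<alpha> k x)) x"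

definition metric_proj :: "'a::metric_space set \<Rightarrow> 'a \<Rightarrow> 'a" where
  "metric_proj C x = (THE p. p \<in> C \<and> dist x p = (INF y\<in>C. dist x y))"

end

theory Submission
  imports Defs
begin

text \<open>
  Everything is done with cosines of distances, which are positive because all distances are below
  \<open>\<pi> / 2\<close>. The CAT(1) condition is used only through the spherical Stewart inequality
  (\<open>CAT1_stewart\<close>), which compares the distances from a point \<open>p\<close> to the endpoints and to an
  intermediate point of a geodesic.

  A resolvent point \<open>z\<close> of \<open>x\<close> exists because the perturbed function is uniformly convex at
  midpoints (\<open>prox_ex1\<close>). It has two properties, which hold for both kinds of resolvent. The first
  is \<open>cos d(x,p) \<le> cos d(z,x) cos d(z,p)\<close> for every minimizer \<open>p\<close> (\<open>prox_cosine_inequality\<close>):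
  the resolvent does not move away from \<open>p\<close>, and if it hardly approaches \<open>p\<close>, then it hardly moves.
  The second is that \<open>z\<close> almost minimizes \<open>f\<close> if it is close to \<open>x\<close> (\<open>prox_value_le\<close>).

  Let \<open>p\<close> be the projection of \<open>u\<close> to \<open>F\<close> and \<open>s n = 1 - cos d(x n, p)\<close>. Stewart's
  inequality turns the Halpern step into \<open>s (n + 1) \<le> (1 - \<gamma> n) s n + \<gamma> n \<epsilon>\<close>, unless \<open>x n\<close> is
  substantially closer to \<open>u\<close> than \<open>p\<close> is (\<open>halpern_step\<close>). Here the sum of the weights \<open>\<gamma> n\<close>
  diverges by the last hypothesis of the theorem (\<open>halpern_weights_divergent\<close>). Steps violating the
  inequality do no harm if they decrease \<open>s\<close> by a fixed amount
  (\<open>tendsto_zero_of_halpern_recursion\<close>). Suppose that there are infinitely many violations with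
  arbitrarily small decrease. Along them the W-mappings asymptotically preserve the distance to
  \<open>p\<close>, so that all the resolvents involved asymptotically fix their arguments, which stay close to
  \<open>x n\<close> (\<open>W_mapping_asymptotic_fixed_points\<close>). The asymptotic centre of these \<open>x n\<close> belongs to every
  closed convex set that contains a sequence asymptotic to them (\<open>asymptotic_centre\<close>). Applied to the
  sublevel sets of the \<open>f i\<close> this shows that the centre lies in \<open>F\<close>, and applied to a ball around
  \<open>u\<close> that it is closer to \<open>u\<close> than \<open>p\<close>, contradicting the choice of \<open>p\<close>.
\<close>

section \<open>Elementary trigonometric estimates\<close>

lemma mult_sin_le_sin_mult:
  fixes t D :: real
  assumes "0 \<le> t" "t \<le> 1" "0 \<le> D" "D \<le> pi"
  shows "t * sin D \<le> sin (t * D)"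
proof -
  have "convex_on {0..pi} (\<lambda>x. - sin x)"
  proof (rule f''_ge0_imp_convex)
    show "((\<lambda>x. - sin x) has_real_derivative - cos x) (at x)" for x :: real
      by (auto intro!: derivative_eq_intros)
    show "((\<lambda>x. - cos x) has_real_derivative sin x) (at x)" for x :: real
      by (auto intro!: derivative_eq_intros)
  qed (auto simp: sin_ge_zero)
  from convex_onD[OF this, of t 0 D] assms show ?thesis by simp
qed

lemma square_le_one_minus_cos:
  fixes D :: real
  assumes "0 \<le> D" "D \<le> pi"
  shows "D\<^sup>2 \<le> 5 * (1 - cos D)"
proof -
  have "D / pi * sin (pi / 2) \<le> sin (D / pi * (pi / 2))"
    using assms by (intro mult_sin_le_sin_mult) auto
  then have "D / pi \<le> sin (D / 2)" by simp
  then have "(D / pi)\<^sup>2 \<le> (sin (D / 2))\<^sup>2"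
    using assms by (intro power_mono) auto
  moreover have "cos D = 1 - 2 * (sin (D / 2))\<^sup>2"
    using cos_double_sin[of "D / 2"] by simp
  ultimately have "2 * (D / pi)\<^sup>2 \<le> 1 - cos D" by simp
  then have "2 * D\<^sup>2 \<le> (1 - cos D) * pi\<^sup>2"
    by (simp add: field_simps power2_eq_square)
  moreover have "pi\<^sup>2 \<le> 10"
  proof -
    have "pi\<^sup>2 \<le> (3.15)\<^sup>2"
      using pi_approx by (intro power_mono) auto
    then show ?thesis by (simp add: power2_eq_square)
  qed
  moreover have "(1 - cos D) * pi\<^sup>2 \<le> (1 - cos D) * 10"
    using calculation(2) by (intro mult_left_mono) auto
  ultimately show ?thesis by linarith
qed

lemma abs_cos_diff_le: "\<bar>cos s - cos t\<bar> \<le> \<bar>s - t :: real\<bar>"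
proof -
  have "\<bar>cos s - cos t\<bar> = 2 * (\<bar>sin ((s + t) / 2)\<bar> * \<bar>sin ((t - s) / 2)\<bar>)"
    by (simp add: cos_diff_cos abs_mult)
  also have "\<dots> \<le> 2 * (1 * \<bar>(t - s) / 2\<bar>)"
    by (intro mult_left_mono mult_mono) (simp_all only: abs_sin_x_le_abs_x abs_sin_le_one abs_ge_zero, simp_all)
  finally show ?thesis by simp
qed

section \<open>Spherical geodesics and the comparison inequality\<close>

lemma S2_inner_le: "\<lbrakk>p \<in> S2; q \<in> S2\<rbrakk> \<Longrightarrow> \<bar>p \<bullet> q\<bar> \<le> 1"
  using Cauchy_Schwarz_ineq2[of p q] by simp

lemma cos_dist_S2: "\<lbrakk>p \<in> S2; q \<in> S2\<rbrakk> \<Longrightarrow> cos (dist_S2 p q) = p \<bullet> q"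
  by (simp add: dist_S2_def S2_inner_le cos_arccos_abs)

lemma S2_inner_self: "p \<in> S2 \<Longrightarrow> p \<bullet> p = 1"
  by (simp add: dot_square_norm)

lemma great_circle_point_in_segment:
  assumes p: "p \<in> S2" and e: "norm e = 1" "p \<bullet> e = 0"
    and q: "q = cos D *\<^sub>R p + sin D *\<^sub>R e"
    and D: "0 \<le> D" "D < pi" and s: "0 \<le> s" "s \<le> D"
  shows "dist_S2 p (cos s *\<^sub>R p + sin s *\<^sub>R e) = s"
    and "cos s *\<^sub>R p + sin s *\<^sub>R e \<in> segment_on S2 dist_S2 p q"
    and "cos s *\<^sub>R p + sin s *\<^sub>R e \<in> S2"
proof -
  define c where "c = (\<lambda>s. cos s *\<^sub>R p + sin s *\<^sub>R e)"
  have pp: "p \<bullet> p = 1" and ee: "e \<bullet> e = 1" and ep: "e \<bullet> p = 0"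
    using p e by (simp_all add: S2_inner_self dot_square_norm inner_commute)
  have inner: "c s \<bullet> c t = cos (s - t)" for s t
    by (simp add: c_def inner_add_left inner_add_right pp ee ep e cos_diff)
  have S2: "c s \<in> S2" for s
    using inner[of s s] by (simp add: norm_eq_sqrt_inner)
  have dist: "dist_S2 (c s) (c t) = \<bar>s - t\<bar>" if "s \<in> {0..D}" "t \<in> {0..D}" for s t
  proof -
    have "dist_S2 (c s) (c t) = arccos (cos \<bar>s - t\<bar>)"
      by (simp add: dist_S2_def inner cos_abs_real)
    also have "\<dots> = \<bar>s - t\<bar>" using that D by (intro arccos_cos) auto
    finally show ?thesis .
  qed
  have c0: "c 0 = p" and cD: "c D = q" by (simp_all add: c_def q)
  have pq: "dist_S2 p q = D" using dist[of 0 D] D by (simp add: c0 cD)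
  show "dist_S2 p (cos s *\<^sub>R p + sin s *\<^sub>R e) = s"
    using dist[of 0 s] s by (simp add: c0) (simp add: c_def)
  have "geodesic_on S2 dist_S2 p q c"
    using S2 dist by (auto simp: geodesic_on_def pq c0 cD)
  then show "cos s *\<^sub>R p + sin s *\<^sub>R e \<in> segment_on S2 dist_S2 p q"
    using s unfolding segment_on_def pq by (auto simp: c_def)
  show "cos s *\<^sub>R p + sin s *\<^sub>R e \<in> S2" using S2[of s] by (simp add: c_def)
qed

lemma great_circle_direction:
  assumes p: "p \<in> S2" and q: "q \<in> S2" and D: "0 < dist_S2 p q" "dist_S2 p q < pi"
  obtains e where "norm e = 1" "p \<bullet> e = 0"
    "q = cos (dist_S2 p q) *\<^sub>R p + sin (dist_S2 p q) *\<^sub>R e"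
proof -
  define D where "D = dist_S2 p q"
  have sD: "sin D > 0" using D by (simp add: D_def sin_gt_zero)
  have pq: "p \<bullet> q = cos D" using cos_dist_S2[OF p q] by (simp add: D_def)
  define e where "e = (1 / sin D) *\<^sub>R (q - cos D *\<^sub>R p)"
  have "(q - cos D *\<^sub>R p) \<bullet> (q - cos D *\<^sub>R p) = 1 - (cos D)\<^sup>2"
    using p q by (simp add: inner_diff_left inner_diff_right S2_inner_self pq
        inner_commute[of q p] power2_eq_square algebra_simps)
  then have "norm (q - cos D *\<^sub>R p) = sin D"
    using sD by (simp add: norm_eq_sqrt_inner flip: sin_squared_eq)
  then have "norm e = 1" using sD by (simp add: e_def)
  moreover have "p \<bullet> e = 0"
    using p by (simp add: e_def inner_diff_right pq S2_inner_self)
  moreover have "q = cos D *\<^sub>R p + sin D *\<^sub>R e"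
    using sD by (simp add: e_def)
  ultimately show thesis using that by (simp add: D_def)
qed

lemma endpoint_in_segment_on_S2:
  assumes p: "p \<in> S2" and q: "q \<in> S2" and D: "dist_S2 p q < pi"
  shows "p \<in> segment_on S2 dist_S2 p q"
proof (cases "dist_S2 p q = 0")
  case True
  have self: "dist_S2 p p = 0" using p by (simp add: dist_S2_def S2_inner_self)
  have "p \<bullet> q = 1" using cos_dist_S2[OF p q] True by simp
  then have "(q - p) \<bullet> (q - p) = 0"
    using p q by (simp add: inner_diff_left inner_diff_right S2_inner_self inner_commute)
  then have "p = q" by simp
  then have "geodesic_on S2 dist_S2 p q (\<lambda>_. p)"
    using p self by (auto simp: geodesic_on_def)
  then show ?thesis using True by (auto simp: segment_on_def)
next
  case False
  moreover have "0 \<le> dist_S2 p q"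
    unfolding dist_S2_def using S2_inner_le[OF p q] by (intro arccos_lbound) auto
  ultimately have pos: "0 < dist_S2 p q" by simp
  then obtain e where "norm e = 1" "p \<bullet> e = 0"
    "q = cos (dist_S2 p q) *\<^sub>R p + sin (dist_S2 p q) *\<^sub>R e"
    using great_circle_direction[OF p q] D by blast
  then show ?thesis
    using great_circle_point_in_segment(2)[of p e q "dist_S2 p q" 0] p pos D by auto
qed

lemma comparison_triangle_exists:
  fixes x y p :: "'a::metric_space"
  assumes "0 < dist x y" and perimeter: "dist x y + dist y p + dist p x < 2 * pi"
  obtains x' y' p' where "comparison_triangle x y p x' y' p'"
proof -
  define a b c where "a = dist x y" and "b = dist p x" and "c = dist y p"
  have tri: "a \<le> b + c" "b \<le> a + c" "c \<le> a + b" "0 < a" "0 \<le> b" "0 \<le> c"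
    using assms dist_triangle[of x y p] dist_triangle[of x p y] dist_triangle[of y p x]
    by (auto simp: a_def b_def c_def dist_commute)
  then have lt: "a < pi" "b < pi" "c < pi" using perimeter by (auto simp: a_def b_def c_def)
  have sa: "sin a > 0" using tri lt by (simp add: sin_gt_zero)
  have sb: "sin b \<ge> 0" using tri lt by (simp add: sin_ge_zero)
  have up: "cos c \<le> cos (a - b)"
  proof -
    have "cos c \<le> cos \<bar>a - b\<bar>" using tri lt by (intro cos_monotone_0_pi_le) auto
    then show ?thesis by (simp add: cos_abs_real)
  qed
  have lo: "cos (a + b) \<le> cos c"
  proof (cases "a + b \<le> pi")
    case True
    then show ?thesis using tri by (intro cos_monotone_0_pi_le) auto
  next
    case False
    have "cos (2 * pi - (a + b)) \<le> cos c"
      using False tri perimeter lt by (intro cos_monotone_0_pi_le) (auto simp: a_def b_def c_def)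
    then show ?thesis by (simp only: cos_2pi_minus)
  qed
  define \<eta> where "\<eta> = (cos c - cos a * cos b) / sin a"
  have "\<bar>\<eta>\<bar> \<le> sin b"
    unfolding \<eta>_def using up lo sa by (auto simp: abs_le_iff field_simps cos_diff cos_add)
  then have "\<bar>\<eta>\<bar>\<^sup>2 \<le> (sin b)\<^sup>2" using sb by (intro power_mono) auto
  then have \<eta>2: "\<eta>\<^sup>2 \<le> (sin b)\<^sup>2" by simp
  define \<zeta> where "\<zeta> = sqrt ((sin b)\<^sup>2 - \<eta>\<^sup>2)"
  have \<zeta>2: "\<zeta>\<^sup>2 = (sin b)\<^sup>2 - \<eta>\<^sup>2" using \<eta>2 by (simp add: \<zeta>_def)
  \<comment> \<open>With the side \<open>x y\<close> on the equator, the distances to \<open>x\<close> and \<open>y\<close> prescribe the first two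
    coordinates of the third vertex. The triangle inequality and the perimeter bound gave
    \<open>\<eta>\<^sup>2 \<le> (sin b)\<^sup>2\<close>, which leaves room for the third.\<close>
  define x' y' p' :: "real^3" where "x' = vector [1, 0, 0]"
    and "y' = vector [cos a, sin a, 0]" and "p' = vector [cos b, \<eta>, \<zeta>]"
  have inner: "v \<bullet> w = v$1 * w$1 + v$2 * w$2 + v$3 * w$3" for v w :: "real^3"
    by (simp add: inner_vec_def sum_3)
  have "x' \<in> S2" "y' \<in> S2"
    by (simp_all add: norm_eq_sqrt_inner inner x'_def y'_def flip: power2_eq_square)
  moreover have "p' \<in> S2"
    using \<zeta>2 by (simp add: norm_eq_sqrt_inner inner p'_def flip: power2_eq_square)
  moreover have "dist_S2 x' y' = a"
    using tri lt by (simp add: dist_S2_def inner x'_def y'_def arccos_cos)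
  moreover have "dist_S2 p' x' = b"
    using tri lt by (simp add: dist_S2_def inner x'_def p'_def arccos_cos)
  moreover have "y' \<bullet> p' = cos c"
    using sa by (simp add: inner y'_def p'_def \<eta>_def)
  then have "dist_S2 y' p' = c" using tri lt by (simp add: dist_S2_def arccos_cos)
  ultimately show thesis
    using that[of x' y' p'] by (simp add: comparison_triangle_def a_def b_def c_def)
qed

lemma CAT1_comparison:
  fixes x y z p q :: "'a::metric_space"
  assumes "CAT1_space TYPE('a)" and "dist x y + dist y z + dist z x < 2 * pi"
    and "comparison_triangle x y z x' y' z'"
    and "comparison_point x y z x' y' z' p p'" "comparison_point x y z x' y' z' q q'"
  shows "dist p q \<le> dist_S2 p' q'"
proof -
  note cat1 = assms(1)[unfolded CAT1_space_def, THEN conjunct2, THEN conjunct2]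
  show ?thesis
    by (rule cat1[rule_format, of x y z x' y' z' p p' q q']) (intro conjI assms(2-5))
qed

lemma CAT1_geodesic_exists:
  fixes x y :: "'a::metric_space"
  assumes "CAT1_space TYPE('a)" and "dist x y < pi"
  obtains c where "geodesic x y c"
  using assms(1)[unfolded CAT1_space_def, THEN conjunct1, rule_format, OF assms(2)] that by blast

lemma CAT1_geodesic_unique:
  fixes x y :: "'a::metric_space"
  assumes "CAT1_space TYPE('a)" and "geodesic x y c" "geodesic x y c'" "s \<in> {0..dist x y}"
  shows "c s = c' s"
proof -
  note cat1 = assms(1)[unfolded CAT1_space_def, THEN conjunct2, THEN conjunct1]
  show ?thesis by (rule cat1[rule_format, of x y c c' s]) (simp_all only: assms(2-4) simp_thms)
qed

lemma geocomb_on_geodesic: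
  fixes x y :: "'a::metric_space"
  assumes "CAT1_space TYPE('a)" and "dist x y < pi" and t: "0 \<le> t" "t \<le> 1"
  obtains c where "geodesic x y c" "geocomb t x y = c ((1 - t) * dist x y)"
proof -
  obtain c where c: "geodesic x y c" by (rule CAT1_geodesic_exists[OF assms(1,2)])
  have "(1 - t) * dist x y \<in> {0..dist x y}" using t by (auto intro: mult_left_le_one_le)
  then have unique: "c' ((1 - t) * dist x y) = c ((1 - t) * dist x y)" if "geodesic x y c'" for c'
    by (rule CAT1_geodesic_unique[OF assms(1) that c])
  have "geocomb t x y = c ((1 - t) * dist x y)"
    unfolding geocomb_def
  proof (rule the_equality)
    show "\<exists>c'. geodesic x y c' \<and> c ((1 - t) * dist x y) = c' ((1 - t) * dist x y)"
      using c by blast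
  qed (metis unique)
  then show thesis by (rule that[OF c])
qed

lemma dist_geocomb:
  fixes x y :: "'a::metric_space"
  assumes "CAT1_space TYPE('a)" and "dist x y < pi" and t: "0 \<le> t" "t \<le> 1"
  shows "dist x (geocomb t x y) = (1 - t) * dist x y"
    and "dist (geocomb t x y) y = t * dist x y"
proof -
  obtain c where c: "geodesic x y c" "geocomb t x y = c ((1 - t) * dist x y)"
    by (rule geocomb_on_geodesic[OF assms])
  have s: "(1 - t) * dist x y \<in> {0..dist x y}" using t by (auto intro: mult_left_le_one_le)
  have iso: "dist (c s) (c s') = \<bar>s - s'\<bar>" if "s \<in> {0..dist x y}" "s' \<in> {0..dist x y}" for s s'
    using c(1) that unfolding geodesic_on_def by blast
  have "dist (c 0) (c ((1 - t) * dist x y)) = \<bar>0 - (1 - t) * dist x y\<bar>"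
    and "dist (c ((1 - t) * dist x y)) (c (dist x y)) = \<bar>(1 - t) * dist x y - dist x y\<bar>"
    by (rule iso; use s in simp)+
  moreover have "\<bar>0 - (1 - t) * dist x y\<bar> = (1 - t) * dist x y" using t by (simp add: abs_mult)
  moreover have "(1 - t) * dist x y - dist x y = - (t * dist x y)" by (simp add: algebra_simps)
  then have "\<bar>(1 - t) * dist x y - dist x y\<bar> = t * dist x y" using t by (simp add: abs_mult)
  moreover have "c 0 = x" "c (dist x y) = y" using c by (simp_all add: geodesic_on_def)
  ultimately show "dist x (geocomb t x y) = (1 - t) * dist x y"
    and "dist (geocomb t x y) y = t * dist x y"
    by (simp_all add: c(2))
qed

text \<open>
  On the sphere this is an equality: the point dividing a great circle arc is a combination of
  the endpoints with the two sines as coefficients, and taking the inner product with the third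
  vertex gives cosines of distances. The comparison condition for a vertex and a point of the
  opposite side turns it into an inequality.
\<close>

lemma CAT1_stewart:
  fixes x y p :: "'a::metric_space"
  assumes cat1: "CAT1_space TYPE('a)"
    and perimeter: "dist x y + dist y p + dist p x < 2 * pi" and t: "0 \<le> t" "t \<le> 1"
  shows "cos (dist x p) * sin (t * dist x y) + cos (dist y p) * sin ((1 - t) * dist x y)
    \<le> cos (dist (geocomb t x y) p) * sin (dist x y)"
proof (cases "dist x y = 0")
  case True
  then show ?thesis by (simp only: True mult_zero_right sin_zero add_0_left order_refl)
next
  case False
  define D where "D = dist x y"
  define s where "s = (1 - t) * D"
  define z where "z = geocomb t x y"
  have D: "0 < D" using False by (simp add: D_def)
  have Dpi: "D < pi" and ppi: "dist p x < pi"
    using perimeter dist_triangle[of x y p] dist_triangle[of p x y]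
    unfolding D_def dist_commute[of x p] dist_commute[of p y] dist_commute[of y x] by linarith+
  have s: "0 \<le> s" "s \<le> D"
    using t D by (auto simp: s_def mult_left_le_one_le)
  obtain x' y' p' where tri: "comparison_triangle x y p x' y' p'"
    by (rule comparison_triangle_exists[OF D[unfolded D_def] perimeter])
  then have S: "x' \<in> S2" "y' \<in> S2" "p' \<in> S2"
    and d: "dist_S2 x' y' = D" "dist_S2 y' p' = dist y p" "dist_S2 p' x' = dist p x"
    unfolding comparison_triangle_def D_def by blast+
  obtain e where e: "norm e = 1" "x' \<bullet> e = 0" and y': "y' = cos D *\<^sub>R x' + sin D *\<^sub>R e"
    using D Dpi unfolding d(1)[symmetric] by (rule great_circle_direction[OF S(1,2)])
  define z' where "z' = cos s *\<^sub>R x' + sin s *\<^sub>R e"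
  note z' = great_circle_point_in_segment[OF S(1) e y' less_imp_le[OF D] Dpi s, folded z'_def]
  obtain c where c: "geodesic x y c" "z = c s"
    using geocomb_on_geodesic[OF cat1 _ t, of x y] Dpi by (auto simp: D_def z_def s_def)
  have "comparison_on_side x y x' y' z z'"
    unfolding comparison_on_side_def
  proof (intro conjI)
    show "z \<in> segment x y" unfolding segment_on_def using c s D_def by auto
    show "dist_S2 x' z' = dist x z"
      using z'(1) dist_geocomb(1)[OF cat1 _ t, of x y] Dpi by (simp add: D_def s_def z_def)
  qed (rule z'(2))
  then have 1: "comparison_point x y p x' y' p' z z'" by (simp add: comparison_point_def)
  obtain c2 where c2: "geodesic p x c2" by (rule CAT1_geodesic_exists[OF cat1 ppi])
  then have "c2 0 = p" by (simp add: geodesic_on_def)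
  then have "p \<in> segment p x"
    unfolding segment_on_def using c2 by (force simp: image_iff)
  moreover have "p' \<in> segment_on S2 dist_S2 p' x'"
    using endpoint_in_segment_on_S2[OF S(3,1)] d ppi by simp
  moreover have "dist_S2 p' p' = dist p p"
    using S by (simp add: dist_S2_def S2_inner_self)
  ultimately have "comparison_on_side p x p' x' p p'" by (simp add: comparison_on_side_def)
  then have 2: "comparison_point x y p x' y' p' p p'" by (simp add: comparison_point_def)
  have le: "dist z p \<le> dist_S2 z' p'"
    using CAT1_comparison[OF cat1 perimeter tri 1 2] .
  have "dist_S2 z' p' \<le> pi"
    unfolding dist_S2_def using S2_inner_le[OF z'(3) S(3)] by (intro arccos_ubound) auto
  then have "cos (dist_S2 z' p') \<le> cos (dist z p)"
    using le by (intro cos_monotone_0_pi_le) auto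
  then have main: "z' \<bullet> p' \<le> cos (dist z p)" using cos_dist_S2[OF z'(3) S(3)] by simp
  have xp: "x' \<bullet> p' = cos (dist x p)" and yp: "y' \<bullet> p' = cos (dist y p)"
    using cos_dist_S2[OF S(3,1)] cos_dist_S2[OF S(2,3)] d by (simp_all add: inner_commute dist_commute)
  have "sin D * (z' \<bullet> p') = sin D * cos s * (x' \<bullet> p') + sin s * (sin D * (e \<bullet> p'))"
    by (simp add: z'_def inner_add_left algebra_simps)
  also have "sin D * (e \<bullet> p') = y' \<bullet> p' - cos D * (x' \<bullet> p')"
    by (simp add: y' inner_add_left)
  also have "sin D * cos s * (x' \<bullet> p') + sin s * (y' \<bullet> p' - cos D * (x' \<bullet> p'))
      = (x' \<bullet> p') * sin (D - s) + (y' \<bullet> p') * sin s"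
    by (simp add: sin_diff algebra_simps)
  finally have "sin D * (z' \<bullet> p') = cos (dist x p) * sin (t * D) + cos (dist y p) * sin ((1 - t) * D)"
    by (simp add: xp yp s_def algebra_simps)
  moreover have "sin D * (z' \<bullet> p') \<le> sin D * cos (dist z p)"
    using main D Dpi by (intro mult_left_mono) (auto simp: sin_ge_zero)
  ultimately show ?thesis by (simp add: z_def D_def mult.commute)
qed

section \<open>Convexity in small spherical spaces\<close>

text \<open>
  From here on the comparison condition enters only through the inequality \<open>stewart\<close>, the
  spherical counterpart of Stewart's theorem. Distances below \<open>\<pi> / 2\<close> make all cosines positive,
  so that \<open>cos (dist x y)\<close> can serve as an order-reversing substitute for the distance.
\<close>

locale spherical_space =
  fixes comb :: "real \<Rightarrow> 'a::complete_space \<Rightarrow> 'a \<Rightarrow> 'a"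
  assumes dist_lt: "dist (x::'a) y < pi / 2"
    and dist_comb_left: "\<lbrakk>0 \<le> t; t \<le> 1\<rbrakk> \<Longrightarrow> dist x (comb t x y) = (1 - t) * dist x y"
    and dist_comb_right: "\<lbrakk>0 \<le> t; t \<le> 1\<rbrakk> \<Longrightarrow> dist (comb t x y) y = t * dist x y"
    and stewart: "\<lbrakk>0 \<le> t; t \<le> 1\<rbrakk> \<Longrightarrow>
      cos (dist x p) * sin (t * dist x y) + cos (dist y p) * sin ((1 - t) * dist x y)
        \<le> cos (dist (comb t x y) p) * sin (dist x y)"

lemma CAT1_imp_spherical_space:
  assumes "CAT1_space TYPE('a::complete_space)" and small: "\<And>v v'::'a. dist v v' < pi / 2"
  shows "spherical_space (geocomb :: real \<Rightarrow> 'a \<Rightarrow> 'a \<Rightarrow> 'a)"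
proof
  fix x y p :: 'a and t :: real
  assume t: "0 \<le> t" "t \<le> 1"
  have xy: "dist x y < pi" using small[of x y] pi_gt_zero by linarith
  show "dist x (geocomb t x y) = (1 - t) * dist x y" "dist (geocomb t x y) y = t * dist x y"
    using dist_geocomb[OF assms(1) xy t] .
  have "dist x y + dist y p + dist p x < 2 * pi"
    using small[of x y] small[of y p] small[of p x] pi_gt_zero by linarith
  then show "cos (dist x p) * sin (t * dist x y) + cos (dist y p) * sin ((1 - t) * dist x y)
      \<le> cos (dist (geocomb t x y) p) * sin (dist x y)"
    by (rule CAT1_stewart[OF assms(1) _ t])
qed (rule small)

context spherical_space
begin

lemma dist_lt_pi: "dist (x::'a) y < pi"
  using dist_lt[of x y] pi_gt_zero by linarith

lemma cos_dist_pos: "0 < cos (dist (x::'a) y)"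
  using dist_lt[of x y] zero_le_dist[of x y] pi_gt_zero by (intro cos_gt_zero_pi) linarith+

lemma cos_dist_le_iff: "cos (dist (x::'a) y) \<le> cos (dist (v::'a) w) \<longleftrightarrow> dist v w \<le> dist x y"
  using dist_lt_pi[of x y] dist_lt_pi[of v w] by (intro cos_mono_le_eq) auto

lemma cos_dist_diff_le: "\<bar>cos (dist (x::'a) p) - cos (dist y p)\<bar> \<le> dist x y"
proof -
  have "\<bar>cos (dist x p) - cos (dist y p)\<bar> \<le> \<bar>dist x p - dist y p\<bar>" by (rule abs_cos_diff_le)
  also have "\<dots> \<le> dist x y"
    using dist_triangle[of x p y] dist_triangle[of y p x] by (simp add: dist_commute abs_le_iff)
  finally show ?thesis .
qed

lemma square_dist_le: "(dist (x::'a) y)\<^sup>2 \<le> 5 * (1 - cos (dist x y))"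
  using dist_lt_pi[of x y] by (intro square_le_one_minus_cos) auto

lemma comb_same: "\<lbrakk>0 \<le> t; t \<le> 1\<rbrakk> \<Longrightarrow> comb t x x = x"
  using dist_comb_left[of t x x] by simp

lemma midpoint:
  "(cos (dist x p) + cos (dist y p)) / 2 \<le> cos (dist (comb (1/2) x y) p) * cos (dist x y / 2)"
proof (cases "x = y")
  case True
  then show ?thesis by (simp add: comb_same)
next
  case False
  define D where "D = dist x y"
  have "sin (D / 2) > 0" using False dist_lt_pi[of x y] pi_gt_zero zero_less_dist_iff[of x y]
    unfolding D_def by (intro sin_gt_zero) linarith+
  moreover have "(cos (dist x p) + cos (dist y p)) * sin (D / 2)
      \<le> cos (dist (comb (1/2) x y) p) * (2 * sin (D / 2) * cos (D / 2))"
    using stewart[of "1/2" x p y] sin_double[of "D / 2"] by (simp add: D_def distrib_right)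
  then have "(cos (dist x p) + cos (dist y p)) * sin (D / 2)
      \<le> (cos (dist (comb (1/2) x y) p) * (2 * cos (D / 2))) * sin (D / 2)"
    by (simp add: mult_ac)
  ultimately have "cos (dist x p) + cos (dist y p) \<le> cos (dist (comb (1/2) x y) p) * (2 * cos (D / 2))"
    using mult_le_cancel_right_pos by blast
  then show ?thesis by (simp add: D_def)
qed

lemma comb_in_ball:
  assumes "c \<le> cos (dist x p)" "c \<le> cos (dist y p)" and c: "0 \<le> c" and t: "0 \<le> t" "t \<le> 1"
  shows "c \<le> cos (dist (comb t x y) p)"
proof (cases "x = y")
  case True
  then show ?thesis using assms by (simp add: comb_same)
next
  case False
  define D where "D = dist x y"
  have D: "0 < D" "D < pi" using False dist_lt_pi by (auto simp: D_def)
  have sD: "sin D > 0" using D by (simp add: sin_gt_zero)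
  have 1: "t * sin D \<le> sin (t * D)" using t D by (intro mult_sin_le_sin_mult) auto
  have 2: "(1 - t) * sin D \<le> sin ((1 - t) * D)" using t D by (intro mult_sin_le_sin_mult) auto
  have "c * sin D = c * (t * sin D) + c * ((1 - t) * sin D)" by (simp add: algebra_simps)
  also have "\<dots> \<le> cos (dist x p) * sin (t * D) + cos (dist y p) * sin ((1 - t) * D)"
    using assms 1 2 sD by (intro add_mono mult_mono) auto
  also have "\<dots> \<le> cos (dist (comb t x y) p) * sin D"
    using stewart[OF t] by (simp add: D_def)
  finally show ?thesis using sD by simp
qed

definition geo_convex :: "'a set \<Rightarrow> bool" where
  "geo_convex C \<longleftrightarrow> (\<forall>x\<in>C. \<forall>y\<in>C. \<forall>t\<in>{0<..<1}. comb t x y \<in> C)"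

lemma geo_convex_ball: "0 \<le> c \<Longrightarrow> geo_convex {x. c \<le> cos (dist x p)}"
  by (simp add: geo_convex_def comb_in_ball)

lemma closed_ball: "closed {x::'a. c \<le> cos (dist x p)}"
  by (intro closed_Collect_le continuous_intros)

text \<open>
  For a minimizing sequence \<open>v\<close>, the number \<open>e k\<close> is, up to a constant factor, the amount by
  which \<open>v k\<close> fails to be optimal. If the value at midpoints improves by a gap that depends on
  the distance, then this failure bounds the distance.
\<close>

lemma convergent_of_midpoint_gap:
  fixes v :: "nat \<Rightarrow> 'a"
  assumes e: "e \<longlonglongrightarrow> 0" and gap: "\<And>j k. 1 - cos (dist (v j) (v k) / 2) \<le> e j + e k"
  shows "convergent v"
proof -
  have bound: "(dist (v j) (v k))\<^sup>2 \<le> 20 * (e j + e k)" for j k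
  proof -
    have "(dist (v j) (v k) / 2)\<^sup>2 \<le> 5 * (1 - cos (dist (v j) (v k) / 2))"
      using dist_lt_pi[of "v j" "v k"] pi_gt_zero zero_le_dist[of "v j" "v k"]
      by (intro square_le_one_minus_cos) linarith+
    then show ?thesis using gap[of j k] by (simp add: power2_eq_square)
  qed
  have "Cauchy v"
  proof (rule metric_CauchyI)
    fix \<epsilon> :: real assume \<epsilon>: "0 < \<epsilon>"
    then have "\<forall>\<^sub>F n in sequentially. e n < \<epsilon>\<^sup>2 / 40" by (intro order_tendstoD(2)[OF e]) auto
    then obtain N where N: "\<And>n. n \<ge> N \<Longrightarrow> e n < \<epsilon>\<^sup>2 / 40" by (auto simp: eventually_sequentially)
    have "dist (v j) (v k) < \<epsilon>" if "j \<ge> N" "k \<ge> N" for j k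
    proof -
      have "(dist (v j) (v k))\<^sup>2 < \<epsilon>\<^sup>2" using bound[of j k] N[OF that(1)] N[OF that(2)] by argo
      then show ?thesis using \<epsilon> by (auto intro: power_less_imp_less_base)
    qed
    then show "\<exists>M. \<forall>m\<ge>M. \<forall>n\<ge>M. dist (v m) (v n) < \<epsilon>" by blast
  qed
  then show ?thesis by (rule Cauchy_convergent)
qed

end

section \<open>Resolvents and projections\<close>

text \<open>
  Both perturbations \<open>tan d sin d\<close> and \<open>- log cos d\<close> are functions \<open>h\<close> of \<open>c = cos d\<close>. The
  last condition combines midpoint convexity and monotonicity of \<open>h\<close> with a gain of \<open>1 - \<kappa>\<close>:
  by \<open>midpoint\<close> it applies to a geodesic midpoint with \<open>\<kappa>\<close> the cosine of half the length.
\<close>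

definition penalty :: "(real \<Rightarrow> real) \<Rightarrow> bool" where
  "penalty h \<longleftrightarrow> continuous_on {0<..1} h \<and>
     (\<forall>c\<in>{0<..1}. 0 \<le> h c \<and> h c \<le> 1 / c - c) \<and>
     (\<forall>s\<in>{0<..1}. \<forall>s'\<in>{0<..1}. \<forall>\<kappa>\<in>{0<..1}. \<forall>w\<le>1. (s + s') / 2 \<le> w * \<kappa> \<longrightarrow>
        h w \<le> (h s + h s') / 2 - (1 - \<kappa>))"

lemma penalty_nonneg: "\<lbrakk>penalty h; 0 < c; c \<le> 1\<rbrakk> \<Longrightarrow> 0 \<le> h c"
  and penalty_le: "\<lbrakk>penalty h; 0 < c; c \<le> 1\<rbrakk> \<Longrightarrow> h c \<le> 1 / c - c"
  and penalty_gap: "\<lbrakk>penalty h; 0 < s; s \<le> 1; 0 < s'; s' \<le> 1; 0 < \<kappa>; \<kappa> \<le> 1; w \<le> 1;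
    (s + s') / 2 \<le> w * \<kappa>\<rbrakk> \<Longrightarrow> h w \<le> (h s + h s') / 2 - (1 - \<kappa>)"
  unfolding penalty_def Ball_def greaterThanAtMost_iff by blast+

lemma penalty_ln: "penalty (\<lambda>c. - ln c)"
  unfolding penalty_def
proof (intro conjI ballI allI impI)
  show "continuous_on {0<..1} (\<lambda>c::real. - ln c)" by (intro continuous_intros) auto
next
  fix c :: real assume c: "c \<in> {0<..1}"
  then show "0 \<le> - ln c" by simp
  have "ln (1 / c) \<le> 1 / c - 1" using c by (intro ln_le_minus_one) auto
  then show "- ln c \<le> 1 / c - c" using c by (simp add: ln_div)
next
  fix s s' \<kappa> w :: real
  assume s: "s \<in> {0<..1}" "s' \<in> {0<..1}" and \<kappa>: "\<kappa> \<in> {0<..1}"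
    and w: "w \<le> 1" "(s + s') / 2 \<le> w * \<kappa>"
  have "0 < w * \<kappa>" using s w by auto
  then have "0 < w" using \<kappa> by (simp add: zero_less_mult_iff)
  have "s * s' \<le> ((s + s') / 2)\<^sup>2"
    using sum_squares_ge_zero[of "s - s'" 0] by (simp add: power2_eq_square algebra_simps)
  also have "\<dots> \<le> (w * \<kappa>)\<^sup>2" using s w by (intro power_mono) auto
  finally have "ln (s * s') \<le> ln ((w * \<kappa>)\<^sup>2)" using s \<open>0 < w\<close> \<kappa>
    by (intro ln_mono mult_pos_pos) auto
  also have "ln ((w * \<kappa>)\<^sup>2) = 2 * (ln w + ln \<kappa>)"
    using \<open>0 < w\<close> \<kappa> by (simp add: ln_realpow ln_mult)
  finally have "ln s + ln s' \<le> 2 * (ln w + ln \<kappa>)" using s by (simp add: ln_mult)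
  moreover have "ln \<kappa> \<le> \<kappa> - 1" using \<kappa> by (intro ln_le_minus_one) auto
  ultimately show "- ln w \<le> (- ln s + - ln s') / 2 - (1 - \<kappa>)" by argo
qed

lemma penalty_tan_sin: "penalty (\<lambda>c. 1 / c - c)"
  unfolding penalty_def
proof (intro conjI ballI allI impI)
  show "continuous_on {0<..1} (\<lambda>c::real. 1 / c - c)" by (intro continuous_intros) auto
next
  fix c :: real assume c: "c \<in> {0<..1}"
  then have "c * c \<le> 1" by (intro mult_le_one) auto
  then show "0 \<le> 1 / c - c" using c by (simp add: field_simps)
next
  fix s s' \<kappa> w :: real
  assume s: "s \<in> {0<..1}" "s' \<in> {0<..1}" and \<kappa>: "\<kappa> \<in> {0<..1}"
    and w: "w \<le> 1" "(s + s') / 2 \<le> w * \<kappa>"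
  define \<sigma> where "\<sigma> = (s + s') / 2"
  have \<sigma>: "0 < \<sigma>" "\<sigma> \<le> 1" using s by (auto simp: \<sigma>_def)
  have "0 < w * \<kappa>" using s w by auto
  then have w0: "0 < w" using \<kappa> by (simp add: zero_less_mult_iff)
  have "w * \<kappa> \<le> w" using w0 \<kappa> by (intro mult_left_le) auto
  then have "\<sigma> \<le> w" using w by (simp add: \<sigma>_def)
  have "1 / w \<le> \<kappa> / \<sigma>" using w w0 \<sigma> by (simp add: \<sigma>_def field_simps)
  also have "\<kappa> / \<sigma> = 1 / \<sigma> - (1 - \<kappa>) / \<sigma>" by (simp add: diff_divide_distrib)
  also have "\<dots> \<le> 1 / \<sigma> - (1 - \<kappa>)"
  proof -
    have "(1 - \<kappa>) * \<sigma> \<le> 1 - \<kappa>" using \<sigma> \<kappa> by (intro mult_left_le) auto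
    then have "1 - \<kappa> \<le> (1 - \<kappa>) / \<sigma>" using \<sigma> by (simp only: pos_le_divide_eq)
    then show ?thesis by linarith
  qed
  also have "1 / \<sigma> \<le> (1 / s + 1 / s') / 2"
  proof -
    have "4 * (s * s') \<le> (s + s') * (s + s')"
      using sum_squares_ge_zero[of "s - s'" 0] by (simp add: algebra_simps)
    then show ?thesis using s by (simp add: \<sigma>_def field_simps)
  qed
  finally have "1 / w \<le> (1 / s + 1 / s') / 2 - (1 - \<kappa>)" by (simp only: diff_right_mono)
  then show "1 / w - w \<le> (1 / s - s + (1 / s' - s')) / 2 - (1 - \<kappa>)"
    using \<open>\<sigma> \<le> w\<close> unfolding \<sigma>_def by argo
qed simp

lemma penalty_strict_antimono:
  assumes "penalty h" "0 < s" "s < w" "w \<le> 1"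
  shows "h w < h s"
proof -
  have "h w \<le> (h s + h s) / 2 - (1 - s / w)"
    using assms by (intro penalty_gap) auto
  moreover have "s / w < 1" using assms by simp
  ultimately show ?thesis by simp
qed

lemma penalty_cos_le:
  assumes "penalty h" "0 \<le> d" "d \<le> 1"
  shows "h (cos d) \<le> 2 * d\<^sup>2"
proof -
  have "cos (pi / 3) \<le> cos d" using assms pi_gt3 by (intro cos_monotone_0_pi_le) auto
  then have c: "1 / 2 \<le> cos d" by (simp add: cos_60)
  then have "h (cos d) \<le> 1 / cos d - cos d" by (intro penalty_le[OF assms(1)]) auto
  also have "\<dots> = (sin d)\<^sup>2 / cos d"
    using c by (simp add: sin_squared_eq field_simps power2_eq_square)
  also have "\<dots> \<le> (sin d)\<^sup>2 / (1 / 2)" using c by (intro divide_left_mono) auto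
  also have "(sin d)\<^sup>2 \<le> d\<^sup>2"
    using abs_sin_x_le_abs_x[of d] by (simp add: abs_le_square_iff)
  finally show ?thesis by simp
qed

context spherical_space
begin

definition convex_lsc_on :: "'a set \<Rightarrow> ('a \<Rightarrow> real) \<Rightarrow> bool" where
  "convex_lsc_on C g \<longleftrightarrow> geo_convex C \<and>
     (\<forall>x\<in>C. \<forall>y\<in>C. \<forall>t\<in>{0<..<1}. g (comb t x y) \<le> t * g x + (1 - t) * g y) \<and>
     (\<forall>b. closed {x\<in>C. g x \<le> b})"

lemma convex_lsc_onD:
  assumes "convex_lsc_on C g" "x \<in> C" "y \<in> C" "0 < t" "t < 1"
  shows "comb t x y \<in> C" and "g (comb t x y) \<le> t * g x + (1 - t) * g y"
  using assms unfolding convex_lsc_on_def geo_convex_def Ball_def greaterThanLessThan_iff by blast+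

definition is_prox :: "(real \<Rightarrow> real) \<Rightarrow> 'a set \<Rightarrow> ('a \<Rightarrow> real) \<Rightarrow> 'a \<Rightarrow> 'a \<Rightarrow> bool" where
  "is_prox h C g x z \<longleftrightarrow>
     z \<in> C \<and> (\<forall>y\<in>C. g z + h (cos (dist z x)) \<le> g y + h (cos (dist y x)))"

lemma penalized_midpoint_gap:
  assumes h: "penalty h" and g: "convex_lsc_on C g" and y: "y \<in> C" "y' \<in> C"
  shows "\<exists>w\<in>C. g w + h (cos (dist w x)) \<le>
    ((g y + h (cos (dist y x))) + (g y' + h (cos (dist y' x)))) / 2 - (1 - cos (dist y y' / 2))"
proof (rule bexI)
  let ?w = "comb (1/2) y y'"
  show w: "?w \<in> C" by (rule convex_lsc_onD[OF g y]) auto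
  have "cos (dist y y' / 2) > 0"
    using dist_lt[of y y'] zero_le_dist[of y y'] pi_gt_zero by (intro cos_gt_zero_pi) linarith+
  then have "h (cos (dist ?w x)) \<le>
      (h (cos (dist y x)) + h (cos (dist y' x))) / 2 - (1 - cos (dist y y' / 2))"
    using midpoint[of y x y'] cos_dist_pos by (intro penalty_gap[OF h]) auto
  moreover have "g ?w \<le> (1/2) * g y + (1 - 1/2) * g y'"
    by (rule convex_lsc_onD[OF g y]) auto
  ultimately show "g ?w + h (cos (dist ?w x)) \<le>
      ((g y + h (cos (dist y x))) + (g y' + h (cos (dist y' x)))) / 2 - (1 - cos (dist y y' / 2))"
    by (simp add: field_simps)
qed

text \<open>The midpoint gap makes minimizing sequences Cauchy.\<close>

lemma prox_ex1:
  assumes h: "penalty h" and g: "convex_lsc_on C g" and "C \<noteq> {}"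
    and bdd: "\<And>y. y \<in> C \<Longrightarrow> m \<le> g y"
  shows "\<exists>!z. is_prox h C g x z"
proof -
  define V where "V y = g y + h (cos (dist y x))" for y
  define I where "I = Inf (V ` C)"
  have "m \<le> V y" if "y \<in> C" for y
    using bdd[OF that] penalty_nonneg[OF h cos_dist_pos[of y x]] by (simp add: V_def)
  then have bb: "bdd_below (V ` C)" by (auto simp: bdd_below_def)
  have I: "I \<le> V y" if "y \<in> C" for y
    unfolding I_def using bb that by (intro cInf_lower) auto
  have gap: "1 - cos (dist y y' / 2) \<le> (V y + V y') / 2 - I" if "y \<in> C" "y' \<in> C" for y y'
  proof -
    obtain w where "w \<in> C" "V w \<le> (V y + V y') / 2 - (1 - cos (dist y y' / 2))"
      using penalized_midpoint_gap[OF h g \<open>y \<in> C\<close> \<open>y' \<in> C\<close>, of x] unfolding V_def by blast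
    then show ?thesis using I[of w] by argo
  qed
  have "\<exists>y\<in>C. V y < I + inverse (real (Suc n))" for n
    using cInf_lessD[of "V ` C" "I + inverse (real (Suc n))"] \<open>C \<noteq> {}\<close> unfolding I_def by auto
  then obtain v where v: "\<And>n. v n \<in> C" "\<And>n. V (v n) < I + inverse (real (Suc n))" by metis
  have "convergent v"
  proof (rule convergent_of_midpoint_gap)
    show "(\<lambda>n. inverse (real (Suc n))) \<longlonglongrightarrow> 0" by (rule LIMSEQ_inverse_real_of_nat)
    fix j k
    have "0 \<le> inverse (real (Suc j))" "0 \<le> inverse (real (Suc k))" by auto
    then show "1 - cos (dist (v j) (v k) / 2) \<le> inverse (real (Suc j)) + inverse (real (Suc k))"
      using gap[OF v(1) v(1), of j k] v(2)[of j] v(2)[of k] by argo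
  qed
  then obtain z where z: "v \<longlonglongrightarrow> z" by (auto simp: convergent_def)
  have "(\<lambda>n. h (cos (dist (v n) x))) \<longlonglongrightarrow> h (cos (dist z x))"
  proof (rule continuous_on_tendsto_compose[where f = h])
    show "continuous_on {0<..1} h" using h by (simp add: penalty_def)
    show "(\<lambda>n. cos (dist (v n) x)) \<longlonglongrightarrow> cos (dist z x)" by (intro tendsto_intros z)
  qed (use cos_dist_pos in auto)
  then have "(\<lambda>n. I + inverse (real (Suc n)) - h (cos (dist (v n) x))) \<longlonglongrightarrow> I + 0 - h (cos (dist z x))"
    by (intro tendsto_intros LIMSEQ_inverse_real_of_nat)
  then have lim: "(\<lambda>n. I + inverse (real (Suc n)) - h (cos (dist (v n) x))) \<longlonglongrightarrow> I - h (cos (dist z x))"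
    by simp
  have z_sublevel: "z \<in> C \<and> g z \<le> I - h (cos (dist z x)) + \<epsilon>" if "\<epsilon> > 0" for \<epsilon>
  proof -
    have ev: "\<forall>\<^sub>F n in sequentially. I + inverse (real (Suc n)) - h (cos (dist (v n) x))
        < I - h (cos (dist z x)) + \<epsilon>"
      using that by (intro order_tendstoD(2)[OF lim]) auto
    have "closed {y\<in>C. g y \<le> I - h (cos (dist z x)) + \<epsilon>}"
      using g by (simp add: convex_lsc_on_def)
    moreover have "\<forall>\<^sub>F n in sequentially. v n \<in> {y\<in>C. g y \<le> I - h (cos (dist z x)) + \<epsilon>}"
      using ev
    proof eventually_elim
      case (elim n)
      then show ?case using v(1)[of n] v(2)[of n] by (simp add: V_def)
    qed
    ultimately have "z \<in> {y\<in>C. g y \<le> I - h (cos (dist z x)) + \<epsilon>}"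
      by (rule Lim_in_closed_set[OF _ _ sequentially_bot z])
    then show ?thesis by simp
  qed
  from z_sublevel[OF zero_less_one] have "z \<in> C" ..
  have "g z \<le> I - h (cos (dist z x))"
    by (rule field_le_epsilon) (rule conjunct2[OF z_sublevel])
  then have "V z \<le> I" by (simp add: V_def)
  then have prox: "is_prox h C g x z"
    using \<open>z \<in> C\<close> I unfolding is_prox_def V_def by force
  moreover have "z' = z" if z': "is_prox h C g x z'" for z'
  proof -
    have "z' \<in> C" "V z' \<le> V z" using z' \<open>z \<in> C\<close> by (auto simp: is_prox_def V_def)
    then have "1 - cos (dist z z' / 2) \<le> 0"
      using gap[of z z'] \<open>z \<in> C\<close> \<open>V z \<le> I\<close> by argo
    moreover have "(dist z z' / 2)\<^sup>2 \<le> 5 * (1 - cos (dist z z' / 2))"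
      using dist_lt_pi[of z z'] pi_gt_zero zero_le_dist[of z z']
      by (intro square_le_one_minus_cos) linarith+
    ultimately have "(dist z z' / 2)\<^sup>2 \<le> 0" by argo
    then show ?thesis by simp
  qed
  ultimately show ?thesis by blast
qed

text \<open>
  Moving from \<open>z\<close> towards \<open>p\<close> does not increase \<open>g\<close>, hence it cannot decrease the distance
  to \<open>x\<close>. To first order along the geodesic this says that the angle at \<open>z\<close> of the triangle
  \<open>x z p\<close> is at least \<open>\<pi> / 2\<close>, and the asserted inequality is the law of cosines for it.
\<close>

lemma prox_cosine_inequality:
  assumes h: "penalty h" and g: "convex_lsc_on C g" and z: "is_prox h C g x z"
    and p: "p \<in> C" "g p \<le> g z"
  shows "cos (dist p x) \<le> cos (dist z x) * cos (dist z p)"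
proof (cases "p = z")
  case True
  then show ?thesis by simp
next
  case False
  define D where "D = dist p z"
  have D: "0 < D" "D < pi" using False dist_lt_pi by (auto simp: D_def)
  have zC: "z \<in> C" using z by (simp add: is_prox_def)
  have ineq: "cos (dist p x) * cos (t * D / 2) \<le> cos (dist z x) * cos (D - t * D / 2)"
    if t: "0 < t" "t < 1" for t
  proof -
    let ?w = "comb t p z"
    have w: "?w \<in> C" "g ?w \<le> t * g p + (1 - t) * g z"
      using convex_lsc_onD[OF g p(1) zC] t by auto
    have "t * g p \<le> t * g z" using p t by (intro mult_left_mono) auto
    then have "g ?w \<le> g z" using w(2) by (simp add: algebra_simps)
    moreover have "g z + h (cos (dist z x)) \<le> g ?w + h (cos (dist ?w x))"
      using z w(1) by (simp add: is_prox_def)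
    ultimately have "h (cos (dist z x)) \<le> h (cos (dist ?w x))" by linarith
    then have "cos (dist ?w x) \<le> cos (dist z x)"
      using penalty_strict_antimono[OF h cos_dist_pos[of z x], of "cos (dist ?w x)"] by force
    then have "cos (dist ?w x) * sin D \<le> cos (dist z x) * sin D"
      using D by (intro mult_right_mono) (auto simp: sin_ge_zero)
    then have "cos (dist p x) * sin (t * D) \<le> cos (dist z x) * (sin D - sin ((1 - t) * D))"
      using stewart[of t p x z] t by (simp add: D_def algebra_simps)
    also have "sin D - sin ((1 - t) * D) = 2 * sin (t * D / 2) * cos (D - t * D / 2)"
      by (simp add: sin_diff_sin field_simps)
    also have "sin (t * D) = 2 * sin (t * D / 2) * cos (t * D / 2)"
      using sin_double[of "t * D / 2"] by simp
    finally have "(cos (dist p x) * cos (t * D / 2)) * sin (t * D / 2)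
        \<le> (cos (dist z x) * cos (D - t * D / 2)) * sin (t * D / 2)"
      by (simp add: mult_ac)
    moreover have "sin (t * D / 2) > 0"
    proof (rule sin_gt_zero)
      have "t * D < 1 * D" using t D by (intro mult_strict_right_mono) auto
      then show "t * D / 2 < pi" using D by linarith
    qed (use t D in auto)
    ultimately show ?thesis using mult_le_cancel_right_pos by blast
  qed
  have "((\<lambda>t. cos (dist p x) * cos (t * D / 2)) \<longlongrightarrow> cos (dist p x) * cos (0 * D / 2)) (at_right 0)"
    by (intro tendsto_intros) auto
  moreover have "((\<lambda>t. cos (dist z x) * cos (D - t * D / 2)) \<longlongrightarrow>
      cos (dist z x) * cos (D - 0 * D / 2)) (at_right 0)"
    by (intro tendsto_intros) auto
  moreover have "\<forall>\<^sub>F t in at_right 0. cos (dist p x) * cos (t * D / 2) \<le> cos (dist z x) * cos (D - t * D / 2)"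
    using ineq by (auto simp: eventually_at_right_field intro!: exI[of _ 1])
  ultimately have "cos (dist p x) * cos (0 * D / 2) \<le> cos (dist z x) * cos (D - 0 * D / 2)"
    by (intro tendsto_le[OF trivial_limit_at_right_real])
  then show ?thesis by (simp add: D_def dist_commute)
qed

text \<open>
  The penalty grows quadratically in the distance, whereas moving the fraction \<open>t\<close> of the way
  towards \<open>p\<close> changes the value of \<open>g\<close> linearly. So \<open>z\<close> almost minimizes \<open>g\<close> when it
  is close to \<open>x\<close>.
\<close>

lemma prox_value_le:
  assumes h: "penalty h" and g: "convex_lsc_on C g" and z: "is_prox h C g x z"
    and p: "p \<in> C" and t: "0 < t" "t \<le> 1/3" and close: "dist z x \<le> t"
  shows "g z \<le> g p + 18 * t"
proof -
  let ?w = "comb t p z"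
  have zC: "z \<in> C" using z by (simp add: is_prox_def)
  have w: "?w \<in> C" "g ?w \<le> t * g p + (1 - t) * g z"
    using convex_lsc_onD[OF g p zC] t by auto
  have "dist ?w z = t * dist p z" using t by (intro dist_comb_right) auto
  also have "\<dots> \<le> t * 2"
    using dist_lt[of p z] pi_less_4 t by (intro mult_left_mono) auto
  finally have wx: "dist ?w x \<le> 3 * t" using close dist_triangle[of ?w x z] by linarith
  have "0 \<le> h (cos (dist z x))" using penalty_nonneg[OF h cos_dist_pos] by simp
  then have "g z \<le> g ?w + h (cos (dist ?w x))"
    using z w(1) unfolding is_prox_def by fastforce
  also have "h (cos (dist ?w x)) \<le> 2 * (dist ?w x)\<^sup>2"
    using wx t by (intro penalty_cos_le[OF h]) auto
  also have "(dist ?w x)\<^sup>2 \<le> (3 * t)\<^sup>2" using wx by (intro power_mono) auto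
  finally have "t * g z \<le> t * (g p + 18 * t)"
    using w(2) by (simp add: power2_eq_square algebra_simps)
  then show ?thesis using t by simp
qed

lemma convex_lsc_on_zero:
  assumes "closed C" "geo_convex C"
  shows "convex_lsc_on C (\<lambda>_. 0)"
proof -
  have "closed {x \<in> C. (0::real) \<le> b}" for b using assms(1) by (cases "0 \<le> b") auto
  then show ?thesis using assms(2) by (simp add: convex_lsc_on_def)
qed

text \<open>The projection is the resolvent of the indicator function of the convex set.\<close>

lemma projection_cosine_inequality:
  assumes C: "closed C" "geo_convex C" "C \<noteq> {}"
  shows "\<exists>z\<in>C. \<forall>y\<in>C. cos (dist y x) \<le> cos (dist z x) * cos (dist z y)"
proof -
  note g = convex_lsc_on_zero[OF C(1,2)]
  obtain z where z: "is_prox (\<lambda>c. - ln c) C (\<lambda>_. 0) x z"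
    using prox_ex1[OF penalty_ln g C(3), of 0 x] by auto
  then have "z \<in> C" by (simp add: is_prox_def)
  moreover have "cos (dist y x) \<le> cos (dist z x) * cos (dist z y)" if "y \<in> C" for y
    using prox_cosine_inequality[OF penalty_ln g z that] by simp
  ultimately show ?thesis by blast
qed

lemma metric_proj_minimizes:
  assumes C: "closed C" "geo_convex C" "C \<noteq> {}"
  shows "metric_proj C x \<in> C" and "\<And>y. y \<in> C \<Longrightarrow> dist x (metric_proj C x) \<le> dist x y"
proof -
  obtain z where z: "z \<in> C" "\<And>y. y \<in> C \<Longrightarrow> cos (dist y x) \<le> cos (dist z x) * cos (dist z y)"
    using projection_cosine_inequality[OF C, of x] by auto
  have le: "dist x z \<le> dist x y" if "y \<in> C" for y
  proof -
    have "cos (dist z x) * cos (dist z y) \<le> cos (dist z x)"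
      using cos_dist_pos[of z x] by (intro mult_left_le) auto
    then have "cos (dist y x) \<le> cos (dist z x)" using z(2)[OF that] by linarith
    then show ?thesis by (simp add: cos_dist_le_iff dist_commute)
  qed
  then have Inf: "(INF y\<in>C. dist x y) = dist x z"
    using z(1) by (intro cInf_eq_minimum) auto
  have "metric_proj C x = z"
    unfolding metric_proj_def
  proof (rule the_equality)
    show "z \<in> C \<and> dist x z = (INF y\<in>C. dist x y)" using z(1) Inf by simp
    fix p assume p: "p \<in> C \<and> dist x p = (INF y\<in>C. dist x y)"
    then have "dist p x = dist z x" by (metis Inf dist_commute)
    then have "cos (dist z x) * 1 \<le> cos (dist z x) * cos (dist z p)"
      using z(2)[of p] p by simp
    then have "1 \<le> cos (dist z p)" using cos_dist_pos[of z x] by simp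
    then have "(dist z p)\<^sup>2 \<le> 0" using square_dist_le[of z p] by argo
    then show "p = z" by simp
  qed
  then show "metric_proj C x \<in> C" and "\<And>y. y \<in> C \<Longrightarrow> dist x (metric_proj C x) \<le> dist x y"
    using z(1) le by auto
qed

section \<open>Asymptotic centres\<close>

text \<open>
  The point \<open>z\<close> is the asymptotic centre of \<open>v\<close>: it maximizes the limit inferior \<open>S\<close> of
  \<open>cos (dist z (v n))\<close>. If it were outside \<open>C\<close>, then by the cosine inequality its projection
  to \<open>C\<close> would be closer by a fixed factor to all the points \<open>w n\<close> and do better.
  The bound \<open>c0\<close> excludes the degenerate case \<open>S = 0\<close>.
\<close>

lemma asymptotic_centre:
  fixes v :: "nat \<Rightarrow> 'a"
  assumes c0: "0 < c0" "\<And>n. c0 \<le> cos (dist q (v n))"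
  shows "\<exists>z. \<forall>C w. closed C \<longrightarrow> geo_convex C \<longrightarrow> (\<forall>\<^sub>F n in sequentially. w n \<in> C) \<longrightarrow>
    (\<lambda>n. dist (w n) (v n)) \<longlonglongrightarrow> 0 \<longrightarrow> z \<in> C"
proof -
  define A where "A = {c. \<exists>y. \<forall>\<^sub>F n in sequentially. c \<le> cos (dist y (v n))}"
  define S where "S = Sup A"
  have "c0 \<in> A" unfolding A_def using c0(2) by (intro CollectI exI[of _ q] always_eventually allI)
  have "c \<le> 1" if c: "c \<in> A" for c
  proof -
    obtain y where "\<forall>\<^sub>F n in sequentially. c \<le> cos (dist y (v n))" using c by (auto simp: A_def)
    then obtain n where "c \<le> cos (dist y (v n))" using eventually_happens'[OF sequentially_bot] by blast
    then show ?thesis using cos_le_one order_trans by blast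
  qed
  then have bdd: "bdd_above A" by (auto simp: bdd_above_def)
  have S_upper: "c \<le> S" if "c \<in> A" for c unfolding S_def using that bdd by (rule cSup_upper)
  have S: "0 < S" using S_upper[OF \<open>c0 \<in> A\<close>] c0(1) by linarith
  have "\<exists>y. \<forall>\<^sub>F n in sequentially. S - inverse (real (Suc k)) \<le> cos (dist y (v n))" for k
  proof -
    have "S - inverse (real (Suc k)) < S" by simp
    then obtain c where "c \<in> A" and c: "S - inverse (real (Suc k)) < c"
      unfolding S_def using less_cSup_iff[OF _ bdd] \<open>c0 \<in> A\<close> by blast
    then obtain y where "\<forall>\<^sub>F n in sequentially. c \<le> cos (dist y (v n))" by (auto simp: A_def)
    then have "\<forall>\<^sub>F n in sequentially. S - inverse (real (Suc k)) \<le> cos (dist y (v n))"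
      by (rule eventually_mono) (use c in linarith)
    then show ?thesis by blast
  qed
  then obtain y where
    y: "\<And>k. \<forall>\<^sub>F n in sequentially. S - inverse (real (Suc k)) \<le> cos (dist (y k) (v n))" by metis
  have "convergent y"
  proof (rule convergent_of_midpoint_gap)
    have "(\<lambda>k. inverse (real (Suc k)) / (2 * S)) \<longlonglongrightarrow> 0 / (2 * S)"
      using S by (intro tendsto_intros LIMSEQ_inverse_real_of_nat) auto
    then show "(\<lambda>k. inverse (real (Suc k)) / (2 * S)) \<longlonglongrightarrow> 0" by simp
    fix j k
    define \<kappa> where "\<kappa> = cos (dist (y j) (y k) / 2)"
    define e where "e = (inverse (real (Suc j)) + inverse (real (Suc k))) / 2"
    have \<kappa>: "0 < \<kappa>"
      unfolding \<kappa>_def using dist_lt[of "y j" "y k"] zero_le_dist[of "y j" "y k"] pi_gt_zero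
      by (intro cos_gt_zero_pi) linarith+
    have "\<forall>\<^sub>F n in sequentially. (S - e) / \<kappa> \<le> cos (dist (comb (1/2) (y j) (y k)) (v n))"
      using y[of j] y[of k]
    proof eventually_elim
      case (elim n)
      then have "S - e \<le> cos (dist (comb (1/2) (y j) (y k)) (v n)) * \<kappa>"
        using midpoint[of "y j" "v n" "y k"] unfolding \<kappa>_def e_def by argo
      then show ?case using \<kappa> by (simp add: pos_divide_le_eq)
    qed
    then have "(S - e) / \<kappa> \<le> S" by (intro S_upper) (auto simp: A_def)
    then have "(1 - \<kappa>) * S \<le> e" using \<kappa> by (simp add: pos_divide_le_eq algebra_simps)
    then have "1 - \<kappa> \<le> e / S" using S by (simp add: pos_le_divide_eq)
    then show "1 - cos (dist (y j) (y k) / 2) \<le>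
        inverse (real (Suc j)) / (2 * S) + inverse (real (Suc k)) / (2 * S)"
      by (simp add: \<kappa>_def e_def add_divide_distrib)
  qed
  then obtain z where z: "y \<longlonglongrightarrow> z" by (auto simp: convergent_def)
  have near: "\<forall>\<^sub>F n in sequentially. S - \<epsilon> \<le> cos (dist z (v n))" if \<epsilon>: "\<epsilon> > 0" for \<epsilon>
  proof -
    have "\<forall>\<^sub>F k in sequentially. dist (y k) z < \<epsilon> / 2" using \<epsilon> by (intro tendstoD[OF z]) auto
    moreover have "\<forall>\<^sub>F k in sequentially. inverse (real (Suc k)) < \<epsilon> / 2"
      using \<epsilon> by (intro order_tendstoD(2)[OF LIMSEQ_inverse_real_of_nat]) auto
    ultimately obtain k where k: "dist (y k) z < \<epsilon> / 2" "inverse (real (Suc k)) < \<epsilon> / 2"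
      using eventually_happens'[OF sequentially_bot eventually_conj] by blast
    show ?thesis
      using y[of k]
    proof eventually_elim
      case (elim n)
      then show ?case using k cos_dist_diff_le[of "y k" "v n" z] by linarith
    qed
  qed
  show ?thesis
  proof (intro exI allI impI, rule ccontr)
    fix C w
    assume C: "closed C" "geo_convex C" and w: "\<forall>\<^sub>F n in sequentially. w n \<in> C"
      and wv: "(\<lambda>n. dist (w n) (v n)) \<longlonglongrightarrow> 0" and zC: "z \<notin> C"
    from eventually_happens'[OF sequentially_bot w] have "C \<noteq> {}" by auto
    note C = C this
    obtain P where P: "P \<in> C"
        "\<And>y. y \<in> C \<Longrightarrow> cos (dist y z) \<le> cos (dist P z) * cos (dist P y)"
      using projection_cosine_inequality[OF C, of z] by auto
    define \<theta> where "\<theta> = cos (dist P z)"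
    have "0 < (dist P z)\<^sup>2" using P(1) zC by auto
    then have \<theta>: "0 < \<theta>" "\<theta> < 1"
      using cos_dist_pos[of P z] square_dist_le[of P z] unfolding \<theta>_def by argo+
    \<comment> \<open>small enough for \<open>\<theta> * (S + 2 * \<epsilon>) \<le> S - 2 * \<epsilon>\<close>\<close>
    define \<epsilon> where "\<epsilon> = S * (1 - \<theta>) / 4"
    have \<epsilon>: "0 < \<epsilon>" using S \<theta> by (simp add: \<epsilon>_def)
    have "S - 2 * \<epsilon> - \<theta> * (S + 2 * \<epsilon>) = S * ((1 - \<theta>) * (1 - \<theta>)) / 2"
      by (simp add: \<epsilon>_def field_simps)
    also have "\<dots> \<ge> 0" using S by simp
    finally have key: "\<theta> * (S + 2 * \<epsilon>) \<le> S - 2 * \<epsilon>" by simp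
    have "\<forall>\<^sub>F n in sequentially. dist (w n) (v n) < \<epsilon>" using \<epsilon> by (intro order_tendstoD(2)[OF wv])
    with near[OF \<epsilon>] w have "\<forall>\<^sub>F n in sequentially. S + \<epsilon> \<le> cos (dist P (v n))"
    proof eventually_elim
      case (elim n)
      have "S - 2 * \<epsilon> \<le> cos (dist (w n) z)"
        using elim cos_dist_diff_le[of "w n" z "v n"] by (simp add: dist_commute)
      also have "\<dots> \<le> \<theta> * cos (dist P (w n))" unfolding \<theta>_def by (rule P(2)[OF elim(2)])
      finally have "\<theta> * (S + 2 * \<epsilon>) \<le> \<theta> * cos (dist P (w n))" using key by linarith
      then have "S + 2 * \<epsilon> \<le> cos (dist P (w n))" using \<theta> by simp
      then show ?case
        using elim cos_dist_diff_le[of "w n" P "v n"] by (simp add: dist_commute)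
    qed
    then have "S + \<epsilon> \<le> S" by (intro S_upper) (auto simp: A_def)
    then show False using \<epsilon> by simp
  qed
qed

end

context spherical_space
begin

section \<open>W-mappings\<close>

text \<open>
  If \<open>x\<close> is at least as close to \<open>p\<close> as \<open>y\<close>, then an inner point of the geodesic gets
  closer to \<open>p\<close> than \<open>y\<close>. As long as \<open>a\<close> and \<open>c\<close> are positive constants, the gain controls
  the length of the geodesic; so this is where the coefficients have to stay away from \<open>0\<close>
  and \<open>1\<close>.
\<close>

lemma geodesic_gain:
  assumes t: "0 \<le> a" "a \<le> t" "t \<le> 1 - a" and c: "0 \<le> c" "c \<le> cos (dist y p)"
    and xy: "cos (dist y p) \<le> cos (dist x p)"
  shows "c * (a * (1 - a)) * (1 - cos (dist x y)) \<le> cos (dist (comb t x y) p) - cos (dist y p)"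
proof (cases "x = y")
  case True
  then show ?thesis using t by (simp add: comb_same)
next
  case False
  define D where "D = dist x y"
  define b where "b = cos (dist (comb t x y) p)"
  define e where "e = cos (dist y p)"
  have t01: "0 \<le> t" "t \<le> 1" using t by auto
  have D: "0 < D / 2" "D / 2 < pi"
    using False dist_lt_pi[of x y] pi_gt_zero zero_less_dist_iff[of x y] unfolding D_def by linarith+
  have sD: "sin (D / 2) > 0" using D by (rule sin_gt_zero)
  have e0: "0 \<le> e" using c by (simp add: e_def)
  have be: "e \<le> b"
    unfolding b_def e_def using xy c t01 by (intro comb_in_ball) auto
  have tD: "t * D = t * (D / 2) + t * (D / 2)" "(1 - t) * D = (1 - t) * (D / 2) + (1 - t) * (D / 2)"
    by (simp_all add: field_simps)
  have "e * (sin (t * D) + sin ((1 - t) * D)) \<le> cos (dist x p) * sin (t * D) + e * sin ((1 - t) * D)"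
  proof -
    have "0 \<le> sin (t * D)"
    proof (rule sin_ge_zero)
      have "t * D \<le> D" using t01 D by (intro mult_left_le_one_le) auto
      then show "t * D \<le> pi" using dist_lt_pi[of x y] by (simp add: D_def)
    qed (use t01 D in auto)
    then show ?thesis using xy by (simp add: e_def distrib_left mult_right_mono)
  qed
  also have "\<dots> \<le> b * sin D" using stewart[OF t01, of x p y] by (simp add: b_def e_def D_def)
  also have "sin (t * D) + sin ((1 - t) * D) = 2 * sin (D / 2) * cos ((1 - 2 * t) * (D / 2))"
  proof -
    have "(t * D + (1 - t) * D) / 2 = D / 2" "(t * D - (1 - t) * D) / 2 = - ((1 - 2 * t) * (D / 2))"
      by (simp_all add: field_simps)
    then show ?thesis by (simp only: sin_plus_sin cos_minus)
  qed
  also have "sin D = 2 * sin (D / 2) * cos (D / 2)" using sin_double[of "D / 2"] by simp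
  finally have "(e * cos ((1 - 2 * t) * (D / 2))) * sin (D / 2) \<le> (b * cos (D / 2)) * sin (D / 2)"
    by (simp add: mult_ac)
  then have "e * cos ((1 - 2 * t) * (D / 2)) \<le> b * cos (D / 2)"
    using sD mult_le_cancel_right_pos by blast
  then have "e * (cos ((1 - 2 * t) * (D / 2)) - cos (D / 2)) \<le> (b - e) * cos (D / 2)"
    by (simp add: algebra_simps)
  also have "\<dots> \<le> b - e" using be by (intro mult_left_le) auto
  also have "cos ((1 - 2 * t) * (D / 2)) - cos (D / 2) = 2 * (sin ((1 - t) * (D / 2)) * sin (t * (D / 2)))"
  proof -
    have "((1 - 2 * t) * (D / 2) + D / 2) / 2 = (1 - t) * (D / 2)"
      "(D / 2 - (1 - 2 * t) * (D / 2)) / 2 = t * (D / 2)" by (simp_all add: field_simps)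
    then show ?thesis by (simp only: cos_diff_cos mult.assoc)
  qed
  finally have gain: "e * (2 * (sin ((1 - t) * (D / 2)) * sin (t * (D / 2)))) \<le> b - e" .
  have "a * (1 - a) \<le> t * (1 - t)"
  proof -
    have "0 \<le> (t - a) * (1 - a - t)" using t by (intro mult_nonneg_nonneg) auto
    then show ?thesis by (simp add: algebra_simps)
  qed
  then have "c * (a * (1 - a)) \<le> e * (t * (1 - t))"
    using c t by (intro mult_mono[of c e "a * (1 - a)"]) (auto simp: e_def)
  then have "c * (a * (1 - a)) * (1 - cos D) \<le> e * (t * (1 - t)) * (1 - cos D)"
    by (rule mult_right_mono) simp
  also have "e * (t * (1 - t)) * (1 - cos D)
      = e * (2 * (((1 - t) * sin (D / 2)) * (t * sin (D / 2))))"
    using cos_double_sin[of "D / 2"] by (simp add: power2_eq_square)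
  also have "\<dots> \<le> e * (2 * (sin ((1 - t) * (D / 2)) * sin (t * (D / 2))))"
  proof -
    have "(1 - t) * sin (D / 2) \<le> sin ((1 - t) * (D / 2))" "t * sin (D / 2) \<le> sin (t * (D / 2))"
      using t01 D by (auto intro!: mult_sin_le_sin_mult simp del: times_divide_eq_right)
    moreover have "0 \<le> (1 - t) * sin (D / 2)" "0 \<le> t * sin (D / 2)" using t01 sD by auto
    ultimately have "((1 - t) * sin (D / 2)) * (t * sin (D / 2))
        \<le> sin ((1 - t) * (D / 2)) * sin (t * (D / 2))"
      by (intro mult_mono) auto
    then show ?thesis using e0 by (intro mult_left_mono) auto
  qed
  also note gain
  finally show ?thesis by (simp add: D_def b_def e_def)
qed

text \<open>
  The hypothesis on \<open>T\<close> is the conclusion of \<open>prox_cosine_inequality\<close>, which implies that \<open>T\<close>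
  does not increase distances to \<open>p\<close>; balls around \<open>p\<close> are convex.
\<close>

lemma W_mapping_quasinonexpansive:
  assumes U0: "U 0 = y"
    and US: "\<And>k. k < r \<Longrightarrow> U (Suc k) = comb (A (Suc k)) (T (Suc k) (U k)) y"
    and A: "\<And>k. k < r \<Longrightarrow> 0 \<le> A (Suc k) \<and> A (Suc k) \<le> 1"
    and T: "\<And>k x. k < r \<Longrightarrow> cos (dist p x) \<le> cos (dist (T (Suc k) x) x) * cos (dist (T (Suc k) x) p)"
  shows "k \<le> r \<Longrightarrow> cos (dist y p) \<le> cos (dist (U k) p)"
    and "k < r \<Longrightarrow> cos (dist (U k) p) \<le> cos (dist (T (Suc k) (U k)) p)"
proof -
  show T': "cos (dist (U k) p) \<le> cos (dist (T (Suc k) (U k)) p)" if "k < r" for k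
  proof -
    have "cos (dist (T (Suc k) (U k)) (U k)) * cos (dist (T (Suc k) (U k)) p)
        \<le> cos (dist (T (Suc k) (U k)) p)"
      using cos_dist_pos[of "T (Suc k) (U k)" p] by (intro mult_left_le_one_le)
        (auto intro: less_imp_le cos_dist_pos)
    then show ?thesis using T[OF that, of "U k"] by (simp add: dist_commute)
  qed
  show "cos (dist y p) \<le> cos (dist (U k) p)" if "k \<le> r" for k
    using that
  proof (induction k)
    case 0
    then show ?case by (simp add: U0)
  next
    case (Suc k)
    then have "cos (dist y p) \<le> cos (dist (T (Suc k) (U k)) p)"
      using T'[of k] by simp
    then show ?case
      using Suc.prems A[of k] cos_dist_pos[of y p] by (subst US) (auto intro!: comb_in_ball)
  qed
qed

lemma dist_tendsto_zeroI:
  fixes v w :: "nat \<Rightarrow> 'a"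
  assumes "\<And>n. 1 - cos (dist (v n) (w n)) \<le> K * e n" and "e \<longlonglongrightarrow> 0"
  shows "(\<lambda>n. dist (v n) (w n)) \<longlonglongrightarrow> 0"
proof -
  have "(\<lambda>n. (dist (v n) (w n))\<^sup>2) \<longlonglongrightarrow> 0"
  proof (rule tendsto_sandwich[OF always_eventually always_eventually tendsto_const])
    show "(\<lambda>n. 5 * (K * e n)) \<longlonglongrightarrow> 0"
      using tendsto_mult_right_zero[OF tendsto_mult_right_zero[OF assms(2)]] .
    show "\<forall>n. (dist (v n) (w n))\<^sup>2 \<le> 5 * (K * e n)"
      using square_dist_le assms(1) by (meson mult_left_mono order_trans zero_le_numeral)
  qed simp
  then show ?thesis by simp
qed

text \<open>
  Suppose that the W-mappings asymptotically do not decrease the distance to the common fixed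
  point \<open>p\<close>. By \<open>geodesic_gain\<close> the two points combined in the outermost step then come
  together, hence the inner mappings do not decrease the distance to \<open>p\<close> either, and one
  descends from \<open>r\<close> to \<open>1\<close>.
\<close>

lemma W_mapping_asymptotic_fixed_points:
  fixes v :: "nat \<Rightarrow> 'a"
  assumes a: "0 < a" "a < 1"
    and A: "\<And>n k. k < r \<Longrightarrow> a \<le> A n (Suc k) \<and> A n (Suc k) \<le> 1 - a"
    and U0: "\<And>n. U n 0 = v n"
    and US: "\<And>n k. k < r \<Longrightarrow> U n (Suc k) = comb (A n (Suc k)) (T (Suc k) (U n k)) (v n)"
    and T: "\<And>k x. k < r \<Longrightarrow> cos (dist p x) \<le> cos (dist (T (Suc k) x) x) * cos (dist (T (Suc k) x) p)"
    and c: "0 < c" "\<And>n. c \<le> cos (dist (v n) p)"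
    and lim: "(\<lambda>n. cos (dist (U n r) p) - cos (dist (v n) p)) \<longlonglongrightarrow> 0"
  shows "k < r \<Longrightarrow> (\<lambda>n. dist (T (Suc k) (U n k)) (v n)) \<longlonglongrightarrow> 0"
    and "k < r \<Longrightarrow> (\<lambda>n. dist (T (Suc k) (U n k)) (U n k)) \<longlonglongrightarrow> 0"
    and "k \<le> r \<Longrightarrow> (\<lambda>n. dist (U n k) (v n)) \<longlonglongrightarrow> 0"
proof -
  define gain where "gain n k = cos (dist (U n k) p) - cos (dist (v n) p)" for n k
  have A01: "0 \<le> A n (Suc k) \<and> A n (Suc k) \<le> 1" if "k < r" for n k
    using A[OF that, of n] a by auto
  have quasi: "k \<le> r \<Longrightarrow> cos (dist (v n) p) \<le> cos (dist (U n k) p)"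
    and quasiT: "k < r \<Longrightarrow> cos (dist (U n k) p) \<le> cos (dist (T (Suc k) (U n k)) p)" for n k
    using W_mapping_quasinonexpansive[of "U n" "v n" r "A n" T p, OF U0 US A01 T] by blast+
  have TU: "(\<lambda>n. dist (T (Suc k) (U n k)) (v n)) \<longlonglongrightarrow> 0"
    if k: "k < r" and gain0: "(\<lambda>n. gain n (Suc k)) \<longlonglongrightarrow> 0" for k
  proof (rule dist_tendsto_zeroI[OF _ gain0])
    fix n
    have "c * (a * (1 - a)) * (1 - cos (dist (T (Suc k) (U n k)) (v n))) \<le> gain n (Suc k)"
      unfolding gain_def US[OF k] using A[OF k, of n] a c quasi[of k n] quasiT[of k n] k
      by (intro geodesic_gain) (auto intro: less_imp_le order_trans)
    moreover have "0 < c * (a * (1 - a))" using a c by simp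
    ultimately have "1 - cos (dist (T (Suc k) (U n k)) (v n)) \<le> gain n (Suc k) / (c * (a * (1 - a)))"
      by (simp only: pos_le_divide_eq mult.commute)
    then show "1 - cos (dist (T (Suc k) (U n k)) (v n)) \<le> 1 / (c * (a * (1 - a))) * gain n (Suc k)"
      by simp
  qed
  have e_lim: "(\<lambda>n. cos (dist (T (Suc k) (U n k)) p) - cos (dist (v n) p)) \<longlonglongrightarrow> 0"
    if k: "k < r" and gain0: "(\<lambda>n. gain n (Suc k)) \<longlonglongrightarrow> 0" for k
    by (rule Lim_null_comparison[OF always_eventually TU[OF that]]) (simp add: cos_dist_diff_le)
  have gain_lim: "(\<lambda>n. gain n k) \<longlonglongrightarrow> 0" if "k \<le> r" for k
    using that
  proof (induction k rule: inc_induct)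
    case base
    then show ?case using lim by (simp add: gain_def)
  next
    case (step k)
    show ?case
    proof (rule tendsto_sandwich[OF always_eventually always_eventually tendsto_const
          e_lim[OF step(2) step(3)]])
      show "\<forall>n. 0 \<le> gain n k" using quasi[of k] step(2) by (simp add: gain_def)
      show "\<forall>n. gain n k \<le> cos (dist (T (Suc k) (U n k)) p) - cos (dist (v n) p)"
        using quasiT[OF step(2)] by (simp add: gain_def)
    qed
  qed
  show TU': "(\<lambda>n. dist (T (Suc k) (U n k)) (v n)) \<longlonglongrightarrow> 0" if "k < r" for k
    using TU gain_lim that by (simp add: Suc_leI)
  show "(\<lambda>n. dist (T (Suc k) (U n k)) (U n k)) \<longlonglongrightarrow> 0" if k: "k < r" for k
  proof (rule dist_tendsto_zeroI[OF _ e_lim[OF k gain_lim]])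
    fix n
    define \<theta> where "\<theta> = cos (dist (T (Suc k) (U n k)) (U n k))"
    define e where "e = cos (dist (T (Suc k) (U n k)) p)"
    have "cos (dist (v n) p) \<le> \<theta> * e"
      using quasi[of k n] T[OF k, of "U n k"] k by (simp add: \<theta>_def e_def dist_commute)
    moreover have "c * (1 - \<theta>) \<le> e * (1 - \<theta>)"
      using c(2)[of n] quasi[of k n] quasiT[OF k, of n] k
      by (intro mult_right_mono) (auto simp: e_def \<theta>_def)
    ultimately have "c * (1 - \<theta>) \<le> e - cos (dist (v n) p)" by (simp add: algebra_simps)
    then show "1 - cos (dist (T (Suc k) (U n k)) (U n k)) \<le>
        1 / c * (cos (dist (T (Suc k) (U n k)) p) - cos (dist (v n) p))"
      using c(1) by (simp add: \<theta>_def e_def field_simps)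
  qed (use k in auto)
  show "(\<lambda>n. dist (U n k) (v n)) \<longlonglongrightarrow> 0" if "k \<le> r" for k
  proof (cases k)
    case 0
    then show ?thesis by (simp add: U0)
  next
    case (Suc j)
    then have j: "j < r" using that by simp
    have "\<forall>n. dist (U n k) (v n) \<le> dist (T (Suc j) (U n j)) (v n)"
      using A01[OF j] dist_comb_right by (simp add: Suc US[OF j] mult_left_le_one_le)
    then show ?thesis
      by (intro tendsto_sandwich[OF always_eventually always_eventually tendsto_const TU'[OF j]]) auto
  qed
qed

end

section \<open>The Halpern recursion\<close>

text \<open>
  The weight with which \<open>u\<close> enters a Halpern step with parameter \<open>\<beta>\<close> at distance \<open>D\<close>,
  measured in the scale of cosines. Its value at \<open>D = 0\<close> is the limit for \<open>D \<rightarrow> 0\<close>.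
\<close>

definition halpern_weight :: "real \<Rightarrow> real \<Rightarrow> real" where
  "halpern_weight \<beta> D = (if D = 0 then \<beta> else 1 - sin ((1 - \<beta>) * D) / sin D)"

text \<open>
  For \<open>D > 0\<close> the subtraction formula and \<open>\<beta> sin D \<le> sin (\<beta> D)\<close> bound the weight below by
  \<open>1 - cos (\<beta> D) + \<beta> cos D\<close>. The first summand is at least \<open>\<beta>\<^sup>2 (1 - cos D)\<close>.
\<close>

lemma halpern_weight_bounds:
  assumes \<beta>: "0 \<le> \<beta>" "\<beta> \<le> 1" and D: "0 \<le> D" "D < pi / 2"
  shows "\<beta> * cos D \<le> halpern_weight \<beta> D" and "\<beta>\<^sup>2 \<le> halpern_weight \<beta> D"
    and "halpern_weight \<beta> D \<le> 1"
proof -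
  have "\<beta> * cos D \<le> halpern_weight \<beta> D \<and> \<beta>\<^sup>2 \<le> halpern_weight \<beta> D \<and> halpern_weight \<beta> D \<le> 1"
  proof (cases "D = 0")
    case True
    then show ?thesis using \<beta> by (simp add: halpern_weight_def power2_eq_square mult_left_le)
  next
    case False
    define \<gamma> where "\<gamma> = halpern_weight \<beta> D"
    have sD: "sin D > 0" using D False pi_gt_zero by (intro sin_gt_zero) linarith+
    have cD: "0 < cos D" using D pi_gt_zero by (intro cos_gt_zero_pi) linarith+
    have \<beta>D: "0 \<le> \<beta> * D" "\<beta> * D \<le> D" "0 \<le> (1 - \<beta>) * D" "(1 - \<beta>) * D \<le> D"
      using \<beta> D by (auto simp: mult_left_le_one_le)
    have \<gamma>: "\<gamma> * sin D = sin D - sin ((1 - \<beta>) * D)"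
      using False sD by (simp add: \<gamma>_def halpern_weight_def field_simps)
    also have "sin ((1 - \<beta>) * D) = sin D * cos (\<beta> * D) - cos D * sin (\<beta> * D)"
      by (simp add: left_diff_distrib sin_diff)
    also have "sin D - (sin D * cos (\<beta> * D) - cos D * sin (\<beta> * D))
        = sin D * (1 - cos (\<beta> * D)) + cos D * sin (\<beta> * D)"
      by (simp add: algebra_simps)
    also have "\<dots> \<ge> sin D * (1 - cos (\<beta> * D)) + cos D * (\<beta> * sin D)"
      using \<beta> D cD pi_gt_zero by (intro add_left_mono mult_left_mono mult_sin_le_sin_mult) linarith+
    finally have "(1 - cos (\<beta> * D) + \<beta> * cos D) * sin D \<le> \<gamma> * sin D" by (simp add: algebra_simps)
    then have main: "1 - cos (\<beta> * D) + \<beta> * cos D \<le> \<gamma>" using sD by simp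
    have "\<beta>\<^sup>2 * (1 - cos D) \<le> 1 - cos (\<beta> * D)"
    proof -
      have "0 \<le> sin (D / 2)" using D pi_gt_zero by (intro sin_ge_zero) linarith+
      then have "0 \<le> \<beta> * sin (D / 2)" using \<beta> by simp
      moreover have "\<beta> * sin (D / 2) \<le> sin (\<beta> * (D / 2))"
        using \<beta> D pi_gt_zero by (intro mult_sin_le_sin_mult) linarith+
      ultimately have "(\<beta> * sin (D / 2))\<^sup>2 \<le> (sin (\<beta> * (D / 2)))\<^sup>2" by (intro power_mono)
      moreover have "cos D = 1 - 2 * (sin (D / 2))\<^sup>2" "cos (\<beta> * D) = 1 - 2 * (sin (\<beta> * (D / 2)))\<^sup>2"
        using cos_double_sin[of "D / 2"] cos_double_sin[of "\<beta> * (D / 2)"] by simp_all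
      ultimately show ?thesis by (simp add: power_mult_distrib)
    qed
    moreover have "\<beta>\<^sup>2 * cos D \<le> \<beta> * cos D"
      using \<beta> cD by (intro mult_right_mono) (auto simp: power2_eq_square mult_left_le)
    ultimately have "\<beta>\<^sup>2 \<le> \<gamma>" using main by (simp add: algebra_simps)
    moreover have "\<beta> * cos D \<le> \<gamma>" using main cos_le_one[of "\<beta> * D"] by linarith
    moreover have "0 \<le> sin ((1 - \<beta>) * D)" using \<beta>D D pi_gt_zero by (intro sin_ge_zero) linarith+
    then have "\<gamma> * sin D \<le> 1 * sin D" using \<gamma> by simp
    then have "\<gamma> \<le> 1" using sD by simp
    ultimately show ?thesis by (simp add: \<gamma>_def)
  qed
  then show "\<beta> * cos D \<le> halpern_weight \<beta> D" and "\<beta>\<^sup>2 \<le> halpern_weight \<beta> D"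
    and "halpern_weight \<beta> D \<le> 1" by auto
qed

text \<open>
  By \<open>stewart\<close> the new value of \<open>1 - cos (dist _ p)\<close> is at most the combination, with weight
  \<open>\<gamma>\<close>, of the value at \<open>w\<close> and \<open>1 - cos (dist u p) cos (\<beta> D / 2) / cos (D - \<beta> D / 2)\<close>. The
  hypothesis \<open>far\<close> says that the latter is at most \<open>\<epsilon>\<close>; for \<open>\<beta> \<rightarrow> 0\<close> it holds as soon as
  \<open>w\<close> is asymptotically not closer to \<open>u\<close> than \<open>p\<close> is.
\<close>

lemma (in spherical_space) halpern_step:
  fixes u w p :: 'a
  assumes \<beta>: "0 < \<beta>" "\<beta> < 1" and D: "D = dist u w" and \<gamma>: "\<gamma> = halpern_weight \<beta> D"
    and far: "(1 - \<epsilon>) * cos (D - \<beta> * D / 2) \<le> cos (dist u p) * cos (\<beta> * D / 2)"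
  shows "1 - cos (dist (comb \<beta> u w) p) \<le> (1 - \<gamma>) * (1 - cos (dist w p)) + \<gamma> * \<epsilon>"
proof (cases "D = 0")
  case True
  then have "w = u" using D by simp
  moreover have "\<beta> * (1 - cos (dist u p)) \<le> \<beta> * \<epsilon>"
    using far True \<beta> by (intro mult_left_mono) auto
  ultimately show ?thesis using True \<beta> \<gamma> by (simp add: comb_same halpern_weight_def algebra_simps)
next
  case False
  then have D0: "0 < D" "D < pi" using D dist_lt_pi by auto
  have sD: "sin D > 0" using D0 by (simp add: sin_gt_zero)
  have "0 \<le> sin (\<beta> * D / 2)"
  proof (rule sin_ge_zero)
    have "\<beta> * D \<le> D" using \<beta> D0 by (intro mult_left_le_one_le) auto
    then show "\<beta> * D / 2 \<le> pi" using D0 by linarith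
  qed (use \<beta> D0 in auto)
  then have "((1 - \<epsilon>) * cos (D - \<beta> * D / 2)) * (2 * sin (\<beta> * D / 2))
      \<le> (cos (dist u p) * cos (\<beta> * D / 2)) * (2 * sin (\<beta> * D / 2))"
    using far by (intro mult_right_mono) auto
  also have "\<dots> = cos (dist u p) * sin (\<beta> * D)"
    using sin_double[of "\<beta> * D / 2"] by simp
  also have "((1 - \<epsilon>) * cos (D - \<beta> * D / 2)) * (2 * sin (\<beta> * D / 2))
      = (1 - \<epsilon>) * (2 * sin (\<beta> * D / 2) * cos (D - \<beta> * D / 2))" by (simp add: mult_ac)
  also have "2 * sin (\<beta> * D / 2) * cos (D - \<beta> * D / 2) = sin D - sin ((1 - \<beta>) * D)"
    by (simp add: sin_diff_sin field_simps)
  also have "sin D - sin ((1 - \<beta>) * D) = \<gamma> * sin D"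
    using False sD by (simp add: \<gamma> halpern_weight_def field_simps)
  finally have 1: "(1 - \<epsilon>) * (\<gamma> * sin D) \<le> cos (dist u p) * sin (\<beta> * D)" .
  have "sin ((1 - \<beta>) * D) = (1 - \<gamma>) * sin D"
    using False sD by (simp add: \<gamma> halpern_weight_def)
  then have "cos (dist u p) * sin (\<beta> * D) + cos (dist w p) * ((1 - \<gamma>) * sin D)
      \<le> cos (dist (comb \<beta> u w) p) * sin D"
    using stewart[of \<beta> u p w] \<beta> by (simp add: D)
  with 1 have "((1 - \<epsilon>) * \<gamma> + cos (dist w p) * (1 - \<gamma>)) * sin D
      \<le> cos (dist (comb \<beta> u w) p) * sin D"
    by (simp add: algebra_simps)
  then have "(1 - \<epsilon>) * \<gamma> + cos (dist w p) * (1 - \<gamma>) \<le> cos (dist (comb \<beta> u w) p)"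
    using sD by simp
  then show ?thesis by (simp add: algebra_simps)
qed

text \<open>
  The truncation \<open>max (s n - \<epsilon>) 0\<close> is eventually decreasing under both alternatives. If its
  limit were positive, the first alternative could happen only finitely often, and then the
  second one together with the divergence of the weights would push it below \<open>0\<close>.
\<close>

lemma tendsto_zero_of_halpern_recursion:
  fixes s \<gamma> :: "nat \<Rightarrow> real"
  assumes s: "\<And>n. 0 \<le> s n" and \<gamma>: "\<And>n. n \<ge> 1 \<Longrightarrow> 0 \<le> \<gamma> n" "\<And>n. n \<ge> 1 \<Longrightarrow> \<gamma> n \<le> 1"
    and divergent: "filterlim (\<lambda>N. \<Sum>n=1..N. \<gamma> n) at_top sequentially"
    and step: "\<And>\<epsilon>. \<lbrakk>0 < \<epsilon>; \<epsilon> < 1\<rbrakk> \<Longrightarrow> \<exists>\<delta>>0. \<forall>\<^sub>F n in sequentially.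
      s (Suc n) < s n - \<delta> \<or> s (Suc n) \<le> (1 - \<gamma> n) * s n + \<gamma> n * \<epsilon>"
  shows "s \<longlonglongrightarrow> 0"
proof -
  have small: "\<forall>\<^sub>F n in sequentially. s n < 2 * \<epsilon>" if \<epsilon>: "0 < \<epsilon>" "\<epsilon> < 1" for \<epsilon>
  proof -
    obtain \<delta> N0 where \<delta>: "\<delta> > 0" and step': "\<And>n. n \<ge> N0 \<Longrightarrow>
        s (Suc n) < s n - \<delta> \<or> s (Suc n) \<le> (1 - \<gamma> n) * s n + \<gamma> n * \<epsilon>"
      using step[OF \<epsilon>] unfolding eventually_sequentially by blast
    define N where "N = max N0 1"
    define v where "v n = max (s n - \<epsilon>) 0" for n
    have v0: "0 \<le> v n" for n by (simp add: v_def)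
    have v_step: "s (Suc n) < s n - \<delta> \<or> v (Suc n) \<le> v n - \<gamma> n * v n" if n: "n \<ge> N" for n
    proof (cases "s (Suc n) < s n - \<delta>")
      case False
      have n1: "n \<ge> 1" "n \<ge> N0" using n by (auto simp: N_def)
      have "s (Suc n) \<le> (1 - \<gamma> n) * s n + \<gamma> n * \<epsilon>" using step'[OF n1(2)] False by blast
      then have "s (Suc n) - \<epsilon> \<le> (1 - \<gamma> n) * (s n - \<epsilon>)" by (simp add: algebra_simps)
      also have "\<dots> \<le> (1 - \<gamma> n) * v n"
        using \<gamma>[OF n1(1)] by (intro mult_left_mono) (auto simp: v_def)
      finally have "s (Suc n) - \<epsilon> \<le> (1 - \<gamma> n) * v n" .
      moreover have "0 \<le> (1 - \<gamma> n) * v n" using \<gamma>[OF n1(1)] v0[of n] by simp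
      ultimately have "v (Suc n) \<le> (1 - \<gamma> n) * v n" by (simp add: v_def)
      then show ?thesis by (simp add: algebra_simps)
    qed simp
    have mono: "v (Suc n) \<le> v n" if n: "n \<ge> N" for n
    proof -
      have "0 \<le> \<gamma> n * v n" using \<gamma>(1)[of n] v0[of n] n by (simp add: N_def)
      then show ?thesis using v_step[OF n] \<delta> by (auto simp: v_def)
    qed
    have "decseq (\<lambda>k. v (k + N))" using mono by (intro decseq_SucI) simp
    then obtain L where L: "(\<lambda>k. v (k + N)) \<longlonglongrightarrow> L" and L_le: "\<And>k. L \<le> v (k + N)"
      using decseq_convergent[of "\<lambda>k. v (k + N)" 0] v0 by blast
    have L_le': "L \<le> v n" if "n \<ge> N" for n using L_le[of "n - N"] that by simp
    have "0 \<le> L" using L v0 by (intro LIMSEQ_le_const[OF L]) auto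
    have "L = 0"
    proof (rule ccontr)
      assume "L \<noteq> 0"
      then have "L > 0" using \<open>0 \<le> L\<close> by simp
      have "v \<longlonglongrightarrow> L" using L by (rule LIMSEQ_offset)
      then have "(\<lambda>n. v n - v (Suc n)) \<longlonglongrightarrow> L - L" by (intro tendsto_diff LIMSEQ_Suc)
      then have "\<forall>\<^sub>F n in sequentially. v n - v (Suc n) < \<delta>"
        using \<delta> by (intro order_tendstoD(2)) auto
      then obtain M0 where M0: "\<And>n. n \<ge> M0 \<Longrightarrow> v n - v (Suc n) < \<delta>"
        by (auto simp: eventually_sequentially)
      define M where "M = max M0 N"
      have dec: "L * \<gamma> n + v (Suc n) \<le> v n" if n: "n \<ge> M" for n
      proof -
        have nN: "n \<ge> N" "n \<ge> M0" "n \<ge> 1" using n by (auto simp: M_def N_def)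
        have "v n > 0" "v (Suc n) > 0" using L_le'[of n] L_le'[of "Suc n"] nN \<open>L > 0\<close> by auto
        then have "\<not> s (Suc n) < s n - \<delta>" using M0[OF nN(2)] by (auto simp: v_def)
        then have "v (Suc n) \<le> v n - \<gamma> n * v n" using v_step[OF nN(1)] by blast
        moreover have "L * \<gamma> n \<le> \<gamma> n * v n"
          using mult_left_mono[OF L_le'[OF nN(1)] \<gamma>(1)[OF nN(3)]] by (simp add: mult.commute)
        ultimately show ?thesis by linarith
      qed
      have "L * (\<Sum>n=1..M+j. \<gamma> n) + v (Suc (M + j)) \<le> L * (\<Sum>n=1..M. \<gamma> n) + v (Suc M)" for j
      proof (induction j)
        case (Suc j)
        then show ?case using dec[of "Suc (M + j)"] by (simp add: distrib_left)
      qed simp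
      then have "L * (\<Sum>n=1..M+j. \<gamma> n) \<le> L * (\<Sum>n=1..M. \<gamma> n) + v (Suc M)" for j
        using v0[of "Suc (M + j)"] by (meson add_increasing2 order_refl order_trans)
      then have bound: "(\<Sum>n=1..M+j. \<gamma> n) \<le> (L * (\<Sum>n=1..M. \<gamma> n) + v (Suc M)) / L" for j
        using \<open>L > 0\<close> by (simp add: pos_le_divide_eq mult.commute)
      define B where "B = (L * (\<Sum>n=1..M. \<gamma> n) + v (Suc M)) / L"
      have "\<forall>\<^sub>F n in sequentially. B + 1 \<le> (\<Sum>n=1..n. \<gamma> n)"
        using divergent unfolding filterlim_at_top by blast
      then obtain K where K: "\<And>n. n \<ge> K \<Longrightarrow> B + 1 \<le> (\<Sum>n=1..n. \<gamma> n)"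
        by (auto simp: eventually_sequentially)
      show False using K[of "M + K"] bound[of K] by (simp add: B_def)
    qed
    then have "v \<longlonglongrightarrow> 0" using LIMSEQ_offset[OF L] by simp
    then have "\<forall>\<^sub>F n in sequentially. v n < \<epsilon>" using \<epsilon> by (intro order_tendstoD(2)) auto
    then show ?thesis by eventually_elim (simp add: v_def)
  qed
  show ?thesis
  proof (rule order_tendstoI)
    fix b :: real
    assume "b < 0"
    then show "\<forall>\<^sub>F n in sequentially. b < s n" using s by (auto intro: less_le_trans always_eventually)
  next
    fix b :: real
    assume "0 < b"
    then have "\<forall>\<^sub>F n in sequentially. s n < 2 * min (b / 2) (1 / 2)" by (intro small) auto
    then show "\<forall>\<^sub>F n in sequentially. s n < b" by eventually_elim linarith
  qed
qed

section \<open>Convergence of the iteration\<close>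

context spherical_space
begin

lemma geo_convex_INT: "(\<And>i. i \<in> I \<Longrightarrow> geo_convex (C i)) \<Longrightarrow> geo_convex (\<Inter>i\<in>I. C i)"
  by (simp add: geo_convex_def)

lemma closed_sublevel: "convex_lsc_on C g \<Longrightarrow> closed {y\<in>C. g y \<le> b}"
  by (simp add: convex_lsc_on_def)

lemma geo_convex_sublevel:
  assumes g: "convex_lsc_on C g"
  shows "geo_convex {y\<in>C. g y \<le> b}"
  unfolding geo_convex_def
proof (intro ballI)
  fix x y t
  assume xy: "x \<in> {y\<in>C. g y \<le> b}" "y \<in> {y\<in>C. g y \<le> b}" and t: "t \<in> {0<..<1::real}"
  have "g (comb t x y) \<le> t * g x + (1 - t) * g y" using xy t by (intro convex_lsc_onD[OF g]) auto
  also have "\<dots> \<le> t * b + (1 - t) * b" using xy t by (intro add_mono mult_left_mono) auto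
  finally have "g (comb t x y) \<le> b" by (simp add: algebra_simps)
  moreover have "comb t x y \<in> C" using xy t by (intro convex_lsc_onD[OF g]) auto
  ultimately show "comb t x y \<in> {y\<in>C. g y \<le> b}" by simp
qed

text \<open>
  The point \<open>z\<close> stands for an asymptotic centre of \<open>v\<close>. For every \<open>i\<close> and \<open>t > 0\<close> the
  resolvent points, which are asymptotic to \<open>v\<close>, eventually enter the sublevel set of \<open>g i\<close> at
  the level \<open>g i p + 18 * t\<close> by \<open>prox_value_le\<close>.
\<close>

lemma asymptotic_centre_minimizes:
  fixes v :: "nat \<Rightarrow> 'a"
  assumes h: "\<And>i. i \<in> I \<Longrightarrow> penalty (h i)" and g: "\<And>i. i \<in> I \<Longrightarrow> convex_lsc_on (C i) (g i)"
    and prox: "\<And>i y. i \<in> I \<Longrightarrow> is_prox (h i) (C i) (g i) y (T i y)"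
    and p: "\<And>i. i \<in> I \<Longrightarrow> p \<in> C i"
    and near: "\<And>i. i \<in> I \<Longrightarrow> (\<lambda>k. dist (T i (y i k)) (v k)) \<longlonglongrightarrow> 0"
    and fixed: "\<And>i. i \<in> I \<Longrightarrow> (\<lambda>k. dist (T i (y i k)) (y i k)) \<longlonglongrightarrow> 0"
    and z: "\<And>K w. \<lbrakk>closed K; geo_convex K; \<forall>\<^sub>F k in sequentially. w k \<in> K;
      (\<lambda>k. dist (w k) (v k)) \<longlonglongrightarrow> 0\<rbrakk> \<Longrightarrow> z \<in> K"
    and i: "i \<in> I"
  shows "z \<in> {y \<in> C i. g i y \<le> g i p}"
proof -
  have sub: "z \<in> {y \<in> C i. g i y \<le> g i p + 18 * t}" if t: "0 < t" "t \<le> 1/3" for t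
  proof (rule z[OF closed_sublevel[OF g[OF i]] geo_convex_sublevel[OF g[OF i]] _ near[OF i]])
    have "\<forall>\<^sub>F k in sequentially. dist (T i (y i k)) (y i k) < t"
      using t by (intro order_tendstoD(2)[OF fixed[OF i]])
    then show "\<forall>\<^sub>F k in sequentially. T i (y i k) \<in> {y \<in> C i. g i y \<le> g i p + 18 * t}"
    proof eventually_elim
      case (elim k)
      then show ?case
        using prox_value_le[OF h[OF i] g[OF i] prox[OF i] p[OF i] t] prox[OF i, of "y i k"]
        by (simp add: is_prox_def)
    qed
  qed
  have "g i z \<le> g i p"
  proof (rule field_le_epsilon)
    fix e :: real assume e: "0 < e"
    have "g i z \<le> g i p + 18 * min (1/3) (e / 18)" using sub[of "min (1/3) (e / 18)"] e by simp
    also have "18 * min (1/3) (e / 18) \<le> e" by linarith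
    finally show "g i z \<le> g i p + e" by simp
  qed
  then show ?thesis using sub[of "1/3"] by simp
qed

text \<open>
  Each of the first two alternatives keeps \<open>dist u (w n)\<close> away from \<open>\<pi> / 2\<close>, so that the
  weights are bounded below by a multiple of \<open>\<beta>\<close>. At distances close to \<open>\<pi> / 2\<close> only the
  bound by \<open>\<beta>\<^sup>2\<close> is left, which is what the third alternative is for.
\<close>

lemma halpern_weights_divergent:
  fixes u p x1 :: 'a and w :: "nat \<Rightarrow> 'a" and \<beta> :: "nat \<Rightarrow> real"
  assumes \<beta>: "\<And>n. n \<ge> 1 \<Longrightarrow> 0 < \<beta> n \<and> \<beta> n < 1"
    and \<beta>_sum: "filterlim (\<lambda>N. \<Sum>n=1..N. \<beta> n) at_top sequentially"
    and w: "\<And>n. n \<ge> 1 \<Longrightarrow> dist (w n) p \<le> max (dist u p) (dist x1 p)"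
    and cond:
      "(SUP (v, v')\<in>(UNIV :: ('a \<times> 'a) set). dist v v') < pi / 2 \<or>
       (dist u p < pi / 4 \<and> dist u p + dist x1 p < pi / 2) \<or>
       filterlim (\<lambda>N. \<Sum>n=1..N. (\<beta> n)\<^sup>2) at_top sequentially"
  shows "filterlim (\<lambda>N. \<Sum>n=1..N. halpern_weight (\<beta> n) (dist u (w n))) at_top sequentially"
proof -
  define \<gamma> where "\<gamma> n = halpern_weight (\<beta> n) (dist u (w n))" for n
  have \<gamma>: "\<beta> n * cos (dist u (w n)) \<le> \<gamma> n" "(\<beta> n)\<^sup>2 \<le> \<gamma> n" if "n \<ge> 1" for n
    using halpern_weight_bounds[of "\<beta> n" "dist u (w n)"] \<beta>[OF that] dist_lt
    by (auto simp: \<gamma>_def)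
  have far: ?thesis if m: "m < pi / 2" and le: "\<And>n. n \<ge> 1 \<Longrightarrow> dist u (w n) \<le> m" for m
  proof -
    have "0 \<le> m" using le[of 1] zero_le_dist[of u "w 1"] by linarith
    have cm: "0 < cos m" using m \<open>0 \<le> m\<close> pi_gt_zero by (intro cos_gt_zero_pi) linarith+
    have "filterlim (\<lambda>N. cos m * (\<Sum>n=1..N. \<beta> n)) at_top sequentially"
      by (rule filterlim_tendsto_pos_mult_at_top[OF tendsto_const cm \<beta>_sum])
    then show ?thesis
    proof (rule filterlim_at_top_mono, intro always_eventually allI)
      fix N
      have "cos m * \<beta> n \<le> \<gamma> n" if n: "n \<ge> 1" for n
      proof -
        have "cos m \<le> cos (dist u (w n))"
          using le[OF n] m pi_gt_zero by (intro cos_monotone_0_pi_le zero_le_dist) linarith+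
        then have "\<beta> n * cos m \<le> \<beta> n * cos (dist u (w n))"
          using \<beta>[OF n] by (intro mult_left_mono) auto
        then show ?thesis using \<gamma>(1)[OF n] by (simp add: mult.commute)
      qed
      then show "cos m * (\<Sum>n=1..N. \<beta> n) \<le> (\<Sum>n=1..N. halpern_weight (\<beta> n) (dist u (w n)))"
        unfolding sum_distrib_left by (intro sum_mono) (auto simp: \<gamma>_def)
    qed
  qed
  from cond show ?thesis
  proof (elim disjE conjE)
    assume sup: "(SUP (v, v')\<in>(UNIV :: ('a \<times> 'a) set). dist v v') < pi / 2"
    have "bdd_above ((\<lambda>(v, v'). dist v v') ` (UNIV :: ('a \<times> 'a) set))"
      using dist_lt by (auto simp: bdd_above_def intro!: exI[of _ "pi / 2"] less_imp_le)
    then have "dist u (w n) \<le> (SUP (v, v')\<in>(UNIV :: ('a \<times> 'a) set). dist v v')" for n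
      using cSUP_upper[of "(u, w n)" UNIV "\<lambda>(v, v'). dist v v'"] by simp
    then show ?thesis using far[OF sup] by blast
  next
    assume up: "dist u p < pi / 4" "dist u p + dist x1 p < pi / 2"
    have "dist u (w n) \<le> dist u p + max (dist u p) (dist x1 p)" if "n \<ge> 1" for n
      using w[OF that] dist_triangle2[of u "w n" p] by (simp add: dist_commute)
    then show ?thesis using up by (intro far[of "dist u p + max (dist u p) (dist x1 p)"]) auto
  next
    assume "filterlim (\<lambda>N. \<Sum>n=1..N. (\<beta> n)\<^sup>2) at_top sequentially"
    then show ?thesis
    proof (rule filterlim_at_top_mono, intro always_eventually allI)
      show "(\<Sum>n=1..N. (\<beta> n)\<^sup>2) \<le> (\<Sum>n=1..N. halpern_weight (\<beta> n) (dist u (w n)))" for N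
        using \<gamma>(2) by (intro sum_mono) (auto simp: \<gamma>_def)
    qed
  qed
qed

text \<open>
  If there were steps, infinitely many and with decrease of \<open>1 - cos (dist (x n) p)\<close> tending to
  \<open>0\<close>, that violate the hypothesis of \<open>halpern_step\<close>, then the distances from \<open>u\<close> to the
  points \<open>W n r (x n)\<close> would be below \<open>dist u p\<close> by a fixed amount along them. The asymptotic
  centre of these \<open>x n\<close> lies in \<open>F\<close> and inherits the bound, contrary to the choice of \<open>p\<close>.
\<close>

theorem halpern_W_iteration_converges:
  fixes T :: "nat \<Rightarrow> 'a \<Rightarrow> 'a" and W :: "nat \<Rightarrow> nat \<Rightarrow> 'a \<Rightarrow> 'a" and x :: "nat \<Rightarrow> 'a"
  assumes h: "\<And>i. i \<in> {1..r} \<Longrightarrow> penalty (h i)"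
    and g: "\<And>i. i \<in> {1..r} \<Longrightarrow> convex_lsc_on (C i) (g i)"
    and prox: "\<And>i y. i \<in> {1..r} \<Longrightarrow> is_prox (h i) (C i) (g i) y (T i y)"
    and F_def: "F = (\<Inter>i\<in>{1..r}. {z \<in> C i. \<forall>y\<in>C i. g i z \<le> g i y})"
    and F_nonempty: "F \<noteq> {}"
    and a: "0 < a" "a < 1"
    and \<alpha>: "\<And>n i. n \<ge> 1 \<Longrightarrow> i \<in> {1..r} \<Longrightarrow> \<alpha> n i \<in> {a..1 - a}"
    and W0: "\<And>n y. W n 0 y = y"
    and WS: "\<And>n k y. W n (Suc k) y = comb (\<alpha> n (Suc k)) (T (Suc k) (W n k y)) y"
    and \<beta>: "\<And>n. n \<ge> 1 \<Longrightarrow> 0 < \<beta> n \<and> \<beta> n < 1"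
    and \<beta>_lim: "\<beta> \<longlonglongrightarrow> 0"
    and \<beta>_sum: "filterlim (\<lambda>N. \<Sum>n=1..N. \<beta> n) at_top sequentially"
    and x_rec: "\<And>n. n \<ge> 1 \<Longrightarrow> x (Suc n) = comb (\<beta> n) u (W n r (x n))"
    and cond:
      "(SUP (v, v')\<in>(UNIV :: ('a \<times> 'a) set). dist v v') < pi / 2 \<or>
       (dist u (metric_proj F u) < pi / 4 \<and>
        dist u (metric_proj F u) + dist (x 1) (metric_proj F u) < pi / 2) \<or>
       filterlim (\<lambda>N. \<Sum>n=1..N. (\<beta> n)\<^sup>2) at_top sequentially"
  shows "x \<longlonglongrightarrow> metric_proj F u"
proof -
  define p where "p = metric_proj F u"
  have F_sublevel: "F = (\<Inter>i\<in>{1..r}. {y \<in> C i. g i y \<le> g i q})" if "q \<in> F" for q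
    unfolding F_def
  proof (rule INF_cong[OF refl])
    fix i assume "i \<in> {1..r}"
    then have "q \<in> C i" "\<And>y. y \<in> C i \<Longrightarrow> g i q \<le> g i y" using that by (auto simp: F_def)
    then show "{z \<in> C i. \<forall>y\<in>C i. g i z \<le> g i y} = {y \<in> C i. g i y \<le> g i q}"
      by (auto intro: order_trans)
  qed
  obtain q where q: "q \<in> F" using F_nonempty by auto
  have "closed F" and "geo_convex F"
    unfolding F_sublevel[OF q] by (intro closed_INT geo_convex_INT ballI closed_sublevel geo_convex_sublevel g; assumption)+
  note p_proj = metric_proj_minimizes[OF this F_nonempty, where x = u, folded p_def]
  have "p \<in> F" by (rule p_proj(1))
  have p_min: "dist u p \<le> dist u y" if "y \<in> F" for y by (rule p_proj(2)[OF that])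
  have pC: "p \<in> C i" "\<And>y. y \<in> C i \<Longrightarrow> g i p \<le> g i y" if "i \<in> {1..r}" for i
    using \<open>p \<in> F\<close> that by (auto simp: F_def)
  have T: "cos (dist p y) \<le> cos (dist (T (Suc k) y) y) * cos (dist (T (Suc k) y) p)" if "k < r" for k y
  proof -
    have k: "Suc k \<in> {1..r}" using that by simp
    have "T (Suc k) y \<in> C (Suc k)" using prox[OF k, of y] by (simp add: is_prox_def)
    then show ?thesis by (intro prox_cosine_inequality[OF h[OF k] g[OF k] prox[OF k]] pC[OF k])
  qed
  have \<alpha>': "a \<le> \<alpha> n (Suc k) \<and> \<alpha> n (Suc k) \<le> 1 - a" if "n \<ge> 1" "k < r" for n k
    using \<alpha>[of n "Suc k"] that by simp
  have quasi: "cos (dist y p) \<le> cos (dist (W n r y) p)" if n: "n \<ge> 1" for n y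
  proof -
    have "0 \<le> \<alpha> n (Suc k) \<and> \<alpha> n (Suc k) \<le> 1" if "k < r" for k
      using \<alpha>'[OF n that] a by linarith
    then show ?thesis
      by (intro W_mapping_quasinonexpansive(1)[where U = "\<lambda>k. W n k y", OF W0 WS _ T order_refl])
  qed
  define w where "w n = W n r (x n)" for n
  have x_rec': "x (Suc n) = comb (\<beta> n) u (w n)" if "n \<ge> 1" for n
    using x_rec[OF that] by (simp add: w_def)
  have w_quasi: "cos (dist (x n) p) \<le> cos (dist (w n) p)" if "n \<ge> 1" for n
    using quasi[OF that] by (simp add: w_def)
  define c where "c = min (cos (dist u p)) (cos (dist (x 1) p))"
  have c0: "0 < c" using cos_dist_pos by (simp add: c_def)
  have c: "c \<le> cos (dist (x n) p)" if "n \<ge> 1" for n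
    using that
  proof (induction n rule: dec_induct)
    case base
    then show ?case by (simp add: c_def)
  next
    case (step n)
    then show ?case
      using w_quasi[of n] \<beta>[of n] c0 x_rec'[of n] by (auto intro!: comb_in_ball simp: c_def)
  qed
  have w_dist: "dist (w n) p \<le> max (dist u p) (dist (x 1) p)" if n: "n \<ge> 1" for n
  proof -
    have "c \<le> cos (dist (w n) p)" using c[OF n] w_quasi[OF n] by linarith
    then show ?thesis by (auto simp: c_def min_le_iff_disj cos_dist_le_iff le_max_iff_disj)
  qed
  define D where "D n = dist u (w n)" for n
  define \<gamma> where "\<gamma> n = halpern_weight (\<beta> n) (D n)" for n
  define s where "s n = 1 - cos (dist (x n) p)" for n
  have \<gamma>: "0 \<le> \<gamma> n" "\<gamma> n \<le> 1" if "n \<ge> 1" for n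
    using halpern_weight_bounds[of "\<beta> n" "D n"] \<beta>[OF that] dist_lt[of u "w n"]
      order_trans[OF zero_le_power2] by (auto simp: \<gamma>_def D_def)
  have "s \<longlonglongrightarrow> 0"
  proof (rule tendsto_zero_of_halpern_recursion)
    show "filterlim (\<lambda>N. \<Sum>n=1..N. \<gamma> n) at_top sequentially"
      unfolding \<gamma>_def D_def
      by (rule halpern_weights_divergent[OF \<beta> \<beta>_sum w_dist cond[folded p_def]])
    fix \<epsilon> :: real assume \<epsilon>: "0 < \<epsilon>" "\<epsilon> < 1"
    show "\<exists>\<delta>>0. \<forall>\<^sub>F n in sequentially.
        s (Suc n) < s n - \<delta> \<or> s (Suc n) \<le> (1 - \<gamma> n) * s n + \<gamma> n * \<epsilon>"
    proof (rule ccontr)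
      assume neg: "\<not> ?thesis"
      have "\<exists>n\<ge>Suc k. s n - inverse (real (Suc k)) \<le> s (Suc n) \<and>
          (1 - \<gamma> n) * s n + \<gamma> n * \<epsilon> < s (Suc n)" for k
      proof -
        have "0 < inverse (real (Suc k))" by simp
        then have "\<not> (\<forall>\<^sub>F n in sequentially. s (Suc n) < s n - inverse (real (Suc k)) \<or>
            s (Suc n) \<le> (1 - \<gamma> n) * s n + \<gamma> n * \<epsilon>)" using neg by blast
        then show ?thesis unfolding eventually_sequentially by (meson not_less)
      qed
      then obtain \<phi> where \<phi>: "\<And>k. \<phi> k \<ge> Suc k"
        and slow: "\<And>k. s (\<phi> k) - inverse (real (Suc k)) \<le> s (Suc (\<phi> k))"
        and bad: "\<And>k. (1 - \<gamma> (\<phi> k)) * s (\<phi> k) + \<gamma> (\<phi> k) * \<epsilon> < s (Suc (\<phi> k))"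
        by metis
      have \<phi>1: "\<phi> k \<ge> 1" for k using \<phi>[of k] by simp
      have "filterlim \<phi> sequentially sequentially"
        using \<phi> by (intro filterlim_at_top_mono[OF filterlim_ident] always_eventually allI)
          (auto intro: Suc_leD)
      then have \<beta>\<phi>: "(\<lambda>k. \<beta> (\<phi> k)) \<longlonglongrightarrow> 0" by (rule filterlim_compose[OF \<beta>_lim])
      define v where "v k = x (\<phi> k)" for k
      define U where "U k j = W (\<phi> k) j (v k)" for k j
      have Ur: "U k r = w (\<phi> k)" for k by (simp add: U_def w_def v_def)
      have gain: "(\<lambda>k. cos (dist (U k r) p) - cos (dist (v k) p)) \<longlonglongrightarrow> 0"
      proof (rule tendsto_sandwich[OF always_eventually always_eventually tendsto_const])
        show "\<forall>k. 0 \<le> cos (dist (U k r) p) - cos (dist (v k) p)"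
          using w_quasi[OF \<phi>1] by (simp add: Ur v_def)
        have "cos (dist (U k r) p) - cos (dist (v k) p) \<le> inverse (real (Suc k)) + \<beta> (\<phi> k) * (pi / 2)" for k
        proof -
          have "dist (x (Suc (\<phi> k))) (w (\<phi> k)) = \<beta> (\<phi> k) * D (\<phi> k)"
            using x_rec'[OF \<phi>1] dist_comb_right \<beta>[OF \<phi>1[of k]] by (simp add: D_def)
          also have "\<dots> \<le> \<beta> (\<phi> k) * (pi / 2)"
            using \<beta>[OF \<phi>1[of k]] dist_lt[of u "w (\<phi> k)"] by (intro mult_left_mono) (auto simp: D_def)
          finally show ?thesis
            using slow[of k] cos_dist_diff_le[of "x (Suc (\<phi> k))" p "w (\<phi> k)"]
            by (simp add: s_def Ur v_def)
        qed
        then show "\<forall>k. cos (dist (U k r) p) - cos (dist (v k) p)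
            \<le> inverse (real (Suc k)) + \<beta> (\<phi> k) * (pi / 2)" by blast
        have "(\<lambda>k. inverse (real (Suc k)) + \<beta> (\<phi> k) * (pi / 2)) \<longlonglongrightarrow> 0 + 0 * (pi / 2)"
          by (intro tendsto_intros LIMSEQ_inverse_real_of_nat \<beta>\<phi>)
        then show "(\<lambda>k. inverse (real (Suc k)) + \<beta> (\<phi> k) * (pi / 2)) \<longlonglongrightarrow> 0" by simp
      qed
      have vc: "c \<le> cos (dist (v k) p)" for k using c[OF \<phi>1] by (simp add: v_def)
      have UW: "U k 0 = v k" "U k (Suc j) = comb (\<alpha> (\<phi> k) (Suc j)) (T (Suc j) (U k j)) (v k)" for k j
        by (simp_all add: U_def W0 WS)
      note W_lim = W_mapping_asymptotic_fixed_points[where A = "\<lambda>k. \<alpha> (\<phi> k)" and U = U and v = v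
          and T = T, OF a _ UW(1) _ _ c0 vc gain]
      have near: "(\<lambda>k. dist (T (Suc j) (U k j)) (v k)) \<longlonglongrightarrow> 0"
        and fixed: "(\<lambda>k. dist (T (Suc j) (U k j)) (U k j)) \<longlonglongrightarrow> 0" if "j < r" for j
        by (rule W_lim(1,2); simp add: \<alpha>'[OF \<phi>1] UW(2) T that)+
      have U_near: "(\<lambda>k. dist (U k r) (v k)) \<longlonglongrightarrow> 0"
        by (rule W_lim(3)) (simp_all add: \<alpha>'[OF \<phi>1] UW(2) T)
      have "\<exists>z. \<forall>K w. closed K \<longrightarrow> geo_convex K \<longrightarrow> (\<forall>\<^sub>F k in sequentially. w k \<in> K) \<longrightarrow>
          (\<lambda>k. dist (w k) (v k)) \<longlonglongrightarrow> 0 \<longrightarrow> z \<in> K"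
        using vc by (intro asymptotic_centre[OF c0, of p]) (simp add: dist_commute)
      then obtain z where z: "\<And>K w. \<lbrakk>closed K; geo_convex K; \<forall>\<^sub>F k in sequentially. w k \<in> K;
          (\<lambda>k. dist (w k) (v k)) \<longlonglongrightarrow> 0\<rbrakk> \<Longrightarrow> z \<in> K" by metis
      have "z \<in> {y \<in> C i. g i y \<le> g i p}" if i: "i \<in> {1..r}" for i
      proof (rule asymptotic_centre_minimizes[OF h g prox pC(1) _ _ z i,
            where y = "\<lambda>i k. U k (i - 1)"])
        fix i assume i: "i \<in> {1..r}"
        then have "i - 1 < r" "Suc (i - 1) = i" by auto
        then show "(\<lambda>k. dist (T i (U k (i - 1))) (v k)) \<longlonglongrightarrow> 0"
          and "(\<lambda>k. dist (T i (U k (i - 1))) (U k (i - 1))) \<longlonglongrightarrow> 0"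
          using near[of "i - 1"] fixed[of "i - 1"] by simp_all
      qed
      then have zF: "z \<in> F" unfolding F_sublevel[OF \<open>p \<in> F\<close>] by blast
      define M where "M = cos (dist u p)"
      have M: "0 < M" unfolding M_def by (rule cos_dist_pos)
      \<comment> \<open>Along \<open>\<phi>\<close> the number \<open>M / (1 - \<epsilon>)\<close> is an asymptotic lower bound for \<open>cos (D n)\<close>;
        \<open>c1\<close> lies strictly between \<open>M\<close> and this bound.\<close>
      define c1 where "c1 = (M + M / (1 - \<epsilon>)) / 2"
      have "M < M / (1 - \<epsilon>)" using M \<epsilon> by (simp add: pos_less_divide_eq)
      then have c1: "M < c1" "c1 < M / (1 - \<epsilon>)" unfolding c1_def by argo+
      have D_close: "M * (1 - \<beta> (\<phi> k)) / (1 - \<epsilon>) - \<beta> (\<phi> k) \<le> cos (D (\<phi> k))" for k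
      proof -
        let ?\<beta> = "\<beta> (\<phi> k)" and ?D = "D (\<phi> k)"
        have b: "0 < ?\<beta>" "?\<beta> < 1" using \<beta>[OF \<phi>1] by auto
        have D: "0 \<le> ?D" "?D < pi / 2" using dist_lt by (auto simp: D_def)
        have "cos (?\<beta> * ?D / 2) * M < (1 - \<epsilon>) * cos (?D - ?\<beta> * ?D / 2)"
        proof (rule ccontr)
          assume "\<not> ?thesis"
          then have "1 - cos (dist (comb ?\<beta> u (w (\<phi> k))) p)
              \<le> (1 - \<gamma> (\<phi> k)) * (1 - cos (dist (w (\<phi> k)) p)) + \<gamma> (\<phi> k) * \<epsilon>"
            using b by (intro halpern_step[of _ "D (\<phi> k)"])
              (auto simp: \<gamma>_def D_def M_def mult.commute)
          also have "(1 - \<gamma> (\<phi> k)) * (1 - cos (dist (w (\<phi> k)) p)) \<le> (1 - \<gamma> (\<phi> k)) * s (\<phi> k)"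
            using w_quasi[OF \<phi>1[of k]] \<gamma>[OF \<phi>1[of k]] by (intro mult_left_mono) (auto simp: s_def)
          finally show False using bad[of k] x_rec'[OF \<phi>1[of k]] by (simp add: s_def)
        qed
        then have 1: "cos (?\<beta> * ?D / 2) * M / (1 - \<epsilon>) < cos (?D - ?\<beta> * ?D / 2)"
          using \<epsilon> by (simp add: pos_divide_less_eq mult.commute)
        have "?\<beta> * ?D \<le> ?\<beta> * 2" using b D pi_less_4 by (intro mult_left_mono) auto
        then have half: "0 \<le> ?\<beta> * ?D / 2" "?\<beta> * ?D / 2 \<le> ?\<beta>" using b D by auto
        have "\<bar>cos (?\<beta> * ?D / 2) - cos 0\<bar> \<le> ?\<beta>"
          using abs_cos_diff_le[of "?\<beta> * ?D / 2" 0] half by linarith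
        then have "1 - ?\<beta> \<le> cos (?\<beta> * ?D / 2)" by (simp add: abs_le_iff)
        then have "M * (1 - ?\<beta>) / (1 - \<epsilon>) \<le> cos (?\<beta> * ?D / 2) * M / (1 - \<epsilon>)"
          using M \<epsilon> by (intro divide_right_mono) (auto simp: mult.commute[of M] mult_right_mono)
        moreover have "\<bar>cos (?D - ?\<beta> * ?D / 2) - cos ?D\<bar> \<le> ?\<beta>"
          using abs_cos_diff_le[of "?D - ?\<beta> * ?D / 2" ?D] half by linarith
        ultimately show ?thesis using 1 by linarith
      qed
      have "(\<lambda>k. M * (1 - \<beta> (\<phi> k)) / (1 - \<epsilon>) - \<beta> (\<phi> k)) \<longlonglongrightarrow> M * (1 - 0) / (1 - \<epsilon>) - 0"
        using \<epsilon> by (intro tendsto_intros \<beta>\<phi>) auto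
      then have "\<forall>\<^sub>F k in sequentially. c1 < M * (1 - \<beta> (\<phi> k)) / (1 - \<epsilon>) - \<beta> (\<phi> k)"
        using c1 by (intro order_tendstoD(1)) auto
      then have "\<forall>\<^sub>F k in sequentially. U k r \<in> {y. c1 \<le> cos (dist y u)}"
      proof eventually_elim
        case (elim k)
        then show ?case using D_close[of k] by (simp add: Ur D_def dist_commute)
      qed
      then have "z \<in> {y. c1 \<le> cos (dist y u)}"
        using c1 M by (intro z[OF closed_ball geo_convex_ball _ U_near]) auto
      moreover have "cos (dist z u) \<le> M"
        using p_min[OF zF] by (simp add: M_def cos_dist_le_iff dist_commute)
      ultimately show False using c1 by simp
    qed
  qed (use \<gamma> in \<open>auto simp: s_def\<close>)
  then have "(\<lambda>n. dist (x n) p) \<longlonglongrightarrow> 0"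
    by (intro dist_tendsto_zeroI[where K = 1]) (auto simp: s_def)
  then show ?thesis unfolding p_def[symmetric] by (rule iffD2[OF tendsto_dist_iff])
qed

end

section \<open>Extended-valued convex functions\<close>

lemma argmin_set_add_real:
  fixes f :: "'a \<Rightarrow> ereal" and k :: "'a \<Rightarrow> real"
  assumes range: "\<And>y. f y \<noteq> -\<infinity>" and "proper_fun f"
  shows "argmin_set (\<lambda>y. f y + ereal (k y)) = {z. f z \<noteq> \<infinity> \<and>
    (\<forall>y. f y \<noteq> \<infinity> \<longrightarrow> real_of_ereal (f z) + k z \<le> real_of_ereal (f y) + k y)}"
proof -
  obtain y0 where y0: "f y0 \<noteq> \<infinity>" using assms(2) by (auto simp: proper_fun_def)
  have val: "f y + ereal (k y) = (if f y = \<infinity> then \<infinity> else ereal (real_of_ereal (f y) + k y))" for y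
    using range[of y] by (cases "f y") auto
  show ?thesis
    unfolding argmin_set_def is_arg_min_def val
    using y0 by (auto simp: not_less split: if_splits)
qed

lemma convex_lsc_on_finite_part:
  fixes f :: "'a::complete_space \<Rightarrow> ereal"
  assumes "spherical_space (geocomb :: real \<Rightarrow> 'a \<Rightarrow> 'a \<Rightarrow> 'a)"
    and range: "\<And>y. f y \<noteq> -\<infinity>" and lsc: "lower_semicont f" and conv: "geoconvex_fun f"
  shows "spherical_space.convex_lsc_on geocomb {y. f y \<noteq> \<infinity>} (\<lambda>y. real_of_ereal (f y))"
proof -
  interpret spherical_space "geocomb :: real \<Rightarrow> 'a \<Rightarrow> 'a \<Rightarrow> 'a" by fact
  have val: "f y = ereal (real_of_ereal (f y))" if "f y \<noteq> \<infinity>" for y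
    using range[of y] that by (cases "f y") auto
  have comb: "f (geocomb t x y) \<noteq> \<infinity> \<and>
      real_of_ereal (f (geocomb t x y)) \<le> t * real_of_ereal (f x) + (1 - t) * real_of_ereal (f y)"
    if xy: "f x \<noteq> \<infinity>" "f y \<noteq> \<infinity>" and t: "0 < t" "t < 1" for x y t
  proof -
    have "f (geocomb t x y) \<le> ereal t * f x + ereal (1 - t) * f y"
      using conv t by (simp add: geoconvex_fun_def)
    also have "\<dots> = ereal (t * real_of_ereal (f x) + (1 - t) * real_of_ereal (f y))"
      by (subst val[OF xy(1)], subst val[OF xy(2)]) simp
    finally show ?thesis using range[of "geocomb t x y"] by (cases "f (geocomb t x y)") auto
  qed
  have "{x \<in> {y. f y \<noteq> \<infinity>}. real_of_ereal (f x) \<le> b} = {x. f x \<le> ereal b}" for b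
  proof (rule set_eqI)
    fix x show "x \<in> {x \<in> {y. f y \<noteq> \<infinity>}. real_of_ereal (f x) \<le> b} \<longleftrightarrow> x \<in> {x. f x \<le> ereal b}"
      using range[of x] by (cases "f x") auto
  qed
  then have "closed {x \<in> {y. f y \<noteq> \<infinity>}. real_of_ereal (f x) \<le> b}" for b
    using lsc by (simp add: lower_semicont_def)
  then show ?thesis using comb by (simp add: convex_lsc_on_def geo_convex_def)
qed

text \<open>A minimizer \<open>q\<close> of \<open>f\<close> provides the lower bound under which the resolvent exists.\<close>

lemma resolvent_is_prox:
  fixes f :: "'a::complete_space \<Rightarrow> ereal"
  assumes sph: "spherical_space (geocomb :: real \<Rightarrow> 'a \<Rightarrow> 'a \<Rightarrow> 'a)"
    and range: "\<And>y. f y \<noteq> -\<infinity>" and proper: "proper_fun f"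
    and lsc: "lower_semicont f" and conv: "geoconvex_fun f"
    and q: "q \<in> argmin_set f"
    and R: "R = resolvent_tan_sin f \<or> R = resolvent_log_cos f"
  shows "\<exists>h. penalty h \<and>
    (\<forall>x. spherical_space.is_prox h {y. f y \<noteq> \<infinity>} (\<lambda>y. real_of_ereal (f y)) x (R x))"
proof -
  interpret spherical_space "geocomb :: real \<Rightarrow> 'a \<Rightarrow> 'a \<Rightarrow> 'a" by fact
  let ?C = "{y. f y \<noteq> \<infinity>}" and ?g = "\<lambda>y. real_of_ereal (f y)"
  have "q \<in> argmin_set (\<lambda>y. f y + ereal 0)" using q by (simp flip: zero_ereal_def)
  then have q_min: "q \<in> ?C" "\<And>y. y \<in> ?C \<Longrightarrow> ?g q \<le> ?g y"
    unfolding argmin_set_add_real[OF range proper] by auto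
  have THE_prox: "is_prox h ?C ?g x (THE z. z \<in> argmin_set (\<lambda>y. f y + ereal (h (cos (dist y x)))))"
    if h: "penalty h" for h x
  proof -
    have "z \<in> argmin_set (\<lambda>y. f y + ereal (h (cos (dist y x)))) \<longleftrightarrow> is_prox h ?C ?g x z" for z
      unfolding argmin_set_add_real[OF range proper] is_prox_def by simp
    moreover have "\<exists>!z. is_prox h ?C ?g x z"
      using q_min by (intro prox_ex1[OF h convex_lsc_on_finite_part[OF sph range lsc conv]]) auto
    ultimately show ?thesis by (simp add: theI')
  qed
  from R show ?thesis
  proof
    assume R: "R = resolvent_tan_sin f"
    have "tan (dist y x) * sin (dist y x) = 1 / cos (dist y x) - cos (dist y x)" for y x :: 'a
    proof -
      have "tan (dist y x) * sin (dist y x) = (sin (dist y x))\<^sup>2 / cos (dist y x)"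
        by (simp add: tan_def power2_eq_square)
      also have "\<dots> = 1 / cos (dist y x) - cos (dist y x)"
        using cos_dist_pos[of y x]
          by (simp add: sin_squared_eq diff_divide_distrib) (simp add: power2_eq_square)
      finally show ?thesis .
    qed
    then show ?thesis
      using THE_prox[OF penalty_tan_sin] penalty_tan_sin
      by (intro exI[of _ "\<lambda>c. 1 / c - c"]) (simp add: R resolvent_tan_sin_def)
  next
    assume R: "R = resolvent_log_cos f"
    show ?thesis
      using THE_prox[OF penalty_ln] penalty_ln
      by (intro exI[of _ "\<lambda>c. - ln c"]) (simp add: R resolvent_log_cos_def minus_ereal_def)
  qed
qed

section \<open>The convergence theorem\<close>

theorem theorem4p1:
  fixes f :: "nat \<Rightarrow> 'a::complete_space \<Rightarrow> ereal"
    and R :: "nat \<Rightarrow> 'a \<Rightarrow> 'a"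
    and \<alpha> :: "nat \<Rightarrow> nat \<Rightarrow> real"
    and \<beta> :: "nat \<Rightarrow> real"
    and a :: real
    and r :: nat
    and u :: 'a
    and x :: "nat \<Rightarrow> 'a"
    and F :: "'a set"
  assumes cat1: "CAT1_space TYPE('a)"
    and admissible: "\<And>v v'::'a. dist v v' < pi / 2"
    and r: "r \<ge> 1"
    and f_range: "\<And>i y. i \<in> {1..r} \<Longrightarrow> f i y \<noteq> -\<infinity>"
    and f_proper: "\<And>i. i \<in> {1..r} \<Longrightarrow> proper_fun (f i)"
    and f_lsc: "\<And>i. i \<in> {1..r} \<Longrightarrow> lower_semicont (f i)"
    and f_convex: "\<And>i. i \<in> {1..r} \<Longrightarrow> geoconvex_fun (f i)"
    and F_def: "F = (\<Inter>i\<in>{1..r}. argmin_set (f i))"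
    and F_nonempty: "F \<noteq> {}"
    and a: "0 < a" "a < 1 / 2"
    and \<alpha>: "\<And>n i. n \<ge> 1 \<Longrightarrow> i \<in> {1..r} \<Longrightarrow> \<alpha> n i \<in> {a..1 - a}"
    and R: "\<And>i. i \<in> {1..r} \<Longrightarrow>
              R i = resolvent_tan_sin (f i) \<or> R i = resolvent_log_cos (f i)"
    and \<beta>: "\<And>n. n \<ge> 1 \<Longrightarrow> 0 < \<beta> n \<and> \<beta> n < 1"
    and \<beta>_lim: "\<beta> \<longlonglongrightarrow> 0"
    and \<beta>_sum: "filterlim (\<lambda>N. \<Sum>n=1..N. \<beta> n) at_top sequentially"
    and x_rec: "\<And>n. n \<ge> 1 \<Longrightarrow> x (Suc n) = geocomb (\<beta> n) u (W_mapping R (\<alpha> n) r (x n))"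
    and cond:
      "(SUP (v, v')\<in>(UNIV :: ('a \<times> 'a) set). dist v v') < pi / 2 \<or>
       (dist u (metric_proj F u) < pi / 4 \<and>
        dist u (metric_proj F u) + dist (x 1) (metric_proj F u) < pi / 2) \<or>
       filterlim (\<lambda>N. \<Sum>n=1..N. (\<beta> n)\<^sup>2) at_top sequentially"
  shows "x \<longlonglongrightarrow> metric_proj F u"
proof -
  have sph: "spherical_space (geocomb :: real \<Rightarrow> 'a \<Rightarrow> 'a \<Rightarrow> 'a)"
    by (rule CAT1_imp_spherical_space[OF cat1 admissible])
  then interpret spherical_space "geocomb :: real \<Rightarrow> 'a \<Rightarrow> 'a \<Rightarrow> 'a" .
  let ?C = "\<lambda>i. {y. f i y \<noteq> \<infinity>}" and ?g = "\<lambda>i y. real_of_ereal (f i y)"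
  obtain q where q: "q \<in> F" using F_nonempty by auto
  have "\<exists>h. penalty h \<and> (\<forall>y. is_prox h (?C i) (?g i) y (R i y))" if i: "i \<in> {1..r}" for i
    using q i F_def
    by (intro resolvent_is_prox[OF sph f_range[OF i] f_proper[OF i] f_lsc[OF i] f_convex[OF i] _ R[OF i]])
      auto
  then obtain h where h: "\<And>i. i \<in> {1..r} \<Longrightarrow> penalty (h i)"
    and prox: "\<And>i y. i \<in> {1..r} \<Longrightarrow> is_prox (h i) (?C i) (?g i) y (R i y)" by metis
  have "argmin_set (f i) = {z \<in> ?C i. \<forall>y\<in>?C i. ?g i z \<le> ?g i y}" if i: "i \<in> {1..r}" for i
    using argmin_set_add_real[OF f_range[OF i] f_proper[OF i], of "\<lambda>_. 0"]
    by (simp flip: zero_ereal_def)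
  then have F: "F = (\<Inter>i\<in>{1..r}. {z \<in> ?C i. \<forall>y\<in>?C i. ?g i z \<le> ?g i y})"
    unfolding F_def by (intro INF_cong refl)
  show ?thesis
  proof (rule halpern_W_iteration_converges[where T = R and W = "\<lambda>n. W_mapping R (\<alpha> n)" and a = a])
    show "convex_lsc_on (?C i) (?g i)" if i: "i \<in> {1..r}" for i
      by (rule convex_lsc_on_finite_part[OF sph f_range[OF i] f_lsc[OF i] f_convex[OF i]])
    show "a < 1" using a by linarith
  qed (fact h prox F F_nonempty a(1) \<alpha> W_mapping.simps \<beta> \<beta>_lim \<beta>_sum x_rec cond)+
qed

end
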